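(* Let integers $d\ge1$, $p\ge2$ and $k>d$ vary along a sequence such that $1\ll k\lesssim d\log p$ and $(k-d)p\gg1$ (i.e. $\zeta\gg1/k$), where $\zeta:=\tfrac1k(k-d)\log p$. Let $t_\alpha$, $\alpha\in\mathbb{R}$, be the cutoff times for $\mathbb{Z}_p^d$. Then, for all $\alpha\in\mathbb{R}$, $t_\alpha\sim t_0$ (for both the simple and the directed walk), and furthermore: \begin{itemize} \item if $\zeta\lesssim1$, then $(t_\alpha-t_0)/t_0\lesssim 1\big/\bigl(\sqrt{\zeta k}\,\log(\max\{1/\zeta,e\})\bigr)$ (for both walks); \item if $\zeta\gg1$, then $(t_\alpha-t_0)/t_0\lesssim 1/\sqrt{k}$ for the simple random walk. \end{itemize}
   Context: Asymptotic notation (along the sequence): $a\ll b$ (equivalently $b\gg a$) means $a/b\to0$; $a\lesssim b$ means $a\le Cb$ for a constant $C$ (which may depend on the fixed $\alpha$); $a\sim b$ means $a/b\to1$. The integer $p$ need not be prime. The rate-1 random walk on $\mathbb{Z}_p^k$ started at $0$ jumps at rate 1; at each jump it chooses a uniformly random coordinate and adds to it (mod $p$) either $\pm1$ with probability $1/2$ each (simple walk) or always $+1$ (directed walk). Let $h(t)$ be the Shannon entropy (natural logarithm) of its position at time $t$. For $\alpha\in\mathbb{R}$ the cutoff time $t_\alpha$ is defined by $$h(t_\alpha)=d\log p+2\alpha\sqrt{k\,\min\{\zeta,1\}}.$$ In particular $h(t_0)=d\log p$. *)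

theory Defs
  imports "HOL-Probability.Probability" "HOL-Library.Landau_Symbols"
begin

section \<open>Random walks on the torus\<close>

text \<open>
  An element of \<open>\<int>\<^sub>p\<^sup>k\<close> is represented by a function \<open>x :: nat \<Rightarrow> int\<close> with
  \<open>0 \<le> x i < p\<close> for \<open>i < k\<close> and \<open>x i = 0\<close> for \<open>i \<ge> k\<close>. The walks below start in this set
  and never leave it.
\<close>

datatype walk = Simple | Directed

primrec increment :: "walk \<Rightarrow> int pmf" where
  "increment Simple = pmf_of_set {-1, 1}"
| "increment Directed = return_pmf 1"

definition walk_step :: "walk \<Rightarrow> nat \<Rightarrow> nat \<Rightarrow> (nat \<Rightarrow> int) \<Rightarrow> (nat \<Rightarrow> int) pmf" where
  "walk_step w p k x =
     bind_pmf (pmf_of_set {..<k}) (\<lambda>i.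
       map_pmf (\<lambda>s. x(i := (x i + s) mod int p)) (increment w))"

primrec jump_chain :: "walk \<Rightarrow> nat \<Rightarrow> nat \<Rightarrow> nat \<Rightarrow> (nat \<Rightarrow> int) pmf" where
  "jump_chain w p k 0 = return_pmf (\<lambda>_. 0)"
| "jump_chain w p k (Suc n) = bind_pmf (jump_chain w p k n) (walk_step w p k)"

text \<open>
  The law at time \<open>t \<ge> 0\<close> of the rate-1 walk: the number of jumps up to time \<open>t\<close> is Poisson
  with mean \<open>t\<close> and independent of the jump chain. Time \<open>0\<close> is treated separately since
  \<open>poisson_pmf\<close> is only specified for positive rates.
\<close>

definition walk_law :: "walk \<Rightarrow> nat \<Rightarrow> nat \<Rightarrow> real \<Rightarrow> (nat \<Rightarrow> int) pmf" where
  "walk_law w p k t =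
     (if t = 0 then return_pmf (\<lambda>_. 0) else bind_pmf (poisson_pmf t) (jump_chain w p k))"


section \<open>Entropy and cutoff times\<close>

definition shannon_entropy :: "'a pmf \<Rightarrow> real" where
  "shannon_entropy M = prob_space.entropy (measure_pmf M) (exp 1) (count_space UNIV) (\<lambda>x. x)"

lemma shannon_entropy_eq_expectation:
  "shannon_entropy M = measure_pmf.expectation M (\<lambda>x. - ln (pmf M x))"
proof -
  let ?C = "count_space (UNIV :: 'a set)"
  have ex: "\<exists>f\<in>borel_measurable ?C. density ?C f = measure_pmf M"
    by (rule bexI[where x = "\<lambda>x. ennreal (pmf M x)"]) (simp_all add: measure_pmf_eq_density)
  have "density ?C (RN_deriv ?C (measure_pmf M)) = measure_pmf M"
    unfolding RN_deriv_def using ex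
    by (simp add: Bex_def) (metis (mono_tags, lifting) someI_ex)
  then have "emeasure (density ?C (RN_deriv ?C (measure_pmf M))) {x} = emeasure (measure_pmf M) {x}"
    for x by simp
  then have "RN_deriv ?C (measure_pmf M) x = ennreal (pmf M x)" for x
    by (simp add: emeasure_density emeasure_pmf_single nn_integral_count_space_indicator[symmetric]
        nn_integral_count_space_finite)
  moreover have "distr (measure_pmf M) ?C (\<lambda>x. x) = measure_pmf M"
    by (rule distr_id2) simp
  ultimately show ?thesis
    unfolding shannon_entropy_def prob_space.entropy_def[OF prob_space_measure_pmf] KL_divergence_def
    by (simp add: entropy_density_def comp_def log_def)
qed

lemma shannon_entropy_eq_sum:
  assumes "finite (set_pmf M)"
  shows "shannon_entropy M = - (\<Sum>x\<in>set_pmf M. pmf M x * ln (pmf M x))"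
  unfolding shannon_entropy_eq_expectation
  by (subst integral_measure_pmf[OF assms]) (auto simp: sum_negf)

definition walk_entropy :: "walk \<Rightarrow> nat \<Rightarrow> nat \<Rightarrow> real \<Rightarrow> real" where
  "walk_entropy w p k t = shannon_entropy (walk_law w p k t)"

definition zeta :: "nat \<Rightarrow> nat \<Rightarrow> nat \<Rightarrow> real" where
  "zeta d p k = (real k - real d) * ln (real p) / real k"

text \<open>
  For \<open>p \<ge> 2\<close> and \<open>k \<ge> 1\<close> the entropy increases strictly from \<open>0\<close> at time \<open>0\<close> towards
  \<open>k ln p\<close>, so the cutoff time is well defined as soon as the right-hand side lies in
  \<open>[0, k ln p)\<close>; for fixed \<open>\<alpha>\<close> this holds eventually in the regime considered here, and
  always for \<open>\<alpha> = 0\<close> and \<open>d < k\<close>.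
\<close>

definition cutoff_time :: "walk \<Rightarrow> nat \<Rightarrow> nat \<Rightarrow> nat \<Rightarrow> real \<Rightarrow> real" where
  "cutoff_time w d p k \<alpha> =
     (THE t. 0 \<le> t \<and>
        walk_entropy w p k t =
          real d * ln (real p) + 2 * \<alpha> * sqrt (real k * min (zeta d p k) 1))"

end

theory Submission
  imports Defs
begin

text \<open>
  Because jumps arrive at Poisson times, the coordinates of the walk at time \<open>t\<close> are independent copies
  of the walk on \<open>\<int>\<^sub>p\<close> at time \<open>t / k\<close> (\<open>walk_law_eq_Pi_pmf\<close>, proved by expanding point masses in
  characters of \<open>\<int>\<^sub>p\<^sup>k\<close>). So \<open>h t = k H (t / k)\<close> for the entropy \<open>H\<close> of one coordinate, and with
  the gap \<open>D s = ln p - H s\<close> the cutoff times are \<open>t\<^sub>\<alpha> = k s\<^sub>\<alpha>\<close> where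
  \<open>D s\<^sub>\<alpha> = \<zeta> - 2 \<alpha> sqrt (min \<zeta> 1 / k)\<close>. Everything reduces to a lower bound, uniform in \<open>p\<close>, on how fast
  \<open>D\<close> decreases: at all times \<open>u\<close> with \<open>H u \<ge> c\<close>,

    \<open>- u D' u \<ge> C\<^sup>-\<^sup>1 min (D u) 1 ln (max (1 / D u) e)\<close>.

  Indeed, changing \<open>D\<close> by \<open>2 \<alpha> sqrt (min \<zeta> 1 / k)\<close> from \<open>D s\<^sub>0 = \<zeta>\<close> then changes \<open>ln s\<close> by at most
  \<open>O(1 / (sqrt (k min \<zeta> 1) ln (max (1 / \<zeta>) e)))\<close>, which contains all three claims.

  No derivative is needed for this. The function \<open>D\<close> is convex (\<open>convex_entropy_gap\<close>): entropy is
  submodular, \<open>H(X + Y + Z) + H(X) \<le> H(X + Y) + H(X + Z)\<close> for independent variables, since adding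
  noise decreases mutual information. Hence it is enough to find for each \<open>u\<close> one later time \<open>S\<close> such that the
  chord of \<open>D\<close> from \<open>u\<close> to \<open>S\<close> is steep enough (\<open>entropy_gap_drops\<close>), and convexity passes its slope to all
  chords that end at \<open>u\<close>. There are two regimes.

    \<^item> If \<open>u\<close> is at least of order \<open>p\<^sup>2\<close>, take \<open>S = u + p\<^sup>2\<close>. At time \<open>p\<^sup>2\<close> the law of the walk is bounded below
      by half the uniform law, so that \<open>D\<close> is halved during every period of length \<open>p\<^sup>2\<close>
      (\<open>entropy_gap_halves\<close>). As \<open>D u\<close> is at least of order \<open>exp (- 4 \<pi>\<^sup>2 u / p\<^sup>2)\<close>, because the first
      Fourier coefficient decays no faster (\<open>entropy_gap_lower\<close>), \<open>u\<close> is at least of order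
      \<open>p\<^sup>2 ln (max (1 / D u) e)\<close>; this is where the logarithm comes from.

    \<^item> If \<open>u\<close> is smaller, take \<open>S = M u\<close> for a large constant \<open>M\<close>. Then \<open>H = ln u / 2 + O(1)\<close> at both times
      (\<open>coord_entropy_lower\<close>, \<open>coord_entropy_upper_log\<close>), so the entropy increases by at least \<open>1\<close>. The bounded
      term is uniform because \<open>H u \<ge> c\<close> keeps \<open>u\<close> away from \<open>0\<close> (\<open>time_lower_bound\<close>).

  The Fourier multipliers of the two walks have the same modulus, and the simple walk at time \<open>2 s\<close> is the
  difference of two independent directed walks at time \<open>s\<close>; so one argument treats both.
\<close>


section \<open>Characters and the law of the walk\<close>

definition root_char :: "nat \<Rightarrow> int \<Rightarrow> complex" where
  "root_char p m = cis (2 * pi * of_int m / of_nat p)"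

lemma root_char_add: "root_char p (a + b) = root_char p a * root_char p b"
  by (simp add: root_char_def cis_mult add_divide_distrib distrib_left)

lemma root_char_0 [simp]: "root_char p 0 = 1"
  by (simp add: root_char_def)

lemma norm_root_char [simp]: "norm (root_char p m) = 1"
  by (simp add: root_char_def)

lemma cnj_root_char: "cnj (root_char p m) = root_char p (- m)"
  by (simp add: root_char_def cis_cnj)

lemma root_char_mult_nat: "root_char p (int n * m) = root_char p m ^ n"
  by (induction n) (simp_all add: distrib_right root_char_add)

lemma root_char_eq_1_iff:
  assumes "p > 0"
  shows "root_char p m = 1 \<longleftrightarrow> int p dvd m"
proof
  assume "root_char p m = 1"
  then have "cos (2 * pi * of_int m / of_nat p) = 1"
    by (metis root_char_def cis.sel(1) one_complex.sel(1))
  then obtain n :: int where "2 * pi * of_int m / of_nat p = of_int n * 2 * pi"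
    by (auto simp: cos_one_2pi_int)
  then have "of_int m = (of_int (n * int p) :: real)"
    using assms by (simp add: field_simps)
  then show "int p dvd m"
    by (metis dvd_triv_right of_int_eq_iff)
next
  assume "int p dvd m"
  then obtain n where "m = int p * n" by (auto elim: dvdE)
  then have "2 * pi * of_int m / of_nat p = 2 * pi * of_int n" using assms by simp
  then show "root_char p m = 1" by (simp add: root_char_def)
qed

lemma root_char_mod: "root_char p (j * (m mod int p)) = root_char p (j * m)"
proof (cases "p = 0")
  case False
  have "j * m = j * (m mod int p) + int p * (j * (m div int p))"
    by (metis mult.left_commute mult_div_mod_eq distrib_left add.commute)
  moreover have "root_char p (int p * (j * (m div int p))) = 1"
    using False by (simp add: root_char_eq_1_iff)
  ultimately show ?thesis by (metis root_char_add mult.right_neutral)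
qed simp

lemma sum_root_char:
  assumes "p > 0"
  shows "(\<Sum>j\<in>{0..<int p}. root_char p (j * m)) = (if int p dvd m then of_nat p else 0)"
proof -
  have "(\<Sum>j\<in>{0..<int p}. root_char p (j * m)) = (\<Sum>j<p. root_char p m ^ j)"
    by (rule sum.reindex_bij_witness[of _ int nat]) (auto simp: root_char_mult_nat[symmetric])
  also have "\<dots> = (if int p dvd m then of_nat p else 0)"
  proof (cases "int p dvd m")
    case True
    then show ?thesis using root_char_eq_1_iff[OF assms, of m] by simp
  next
    case False
    have "root_char p m ^ p = 1"
      using assms by (simp add: root_char_mult_nat[symmetric] root_char_eq_1_iff)
    then show ?thesis
      using False root_char_eq_1_iff[OF assms, of m] by (simp add: geometric_sum)
  qed
  finally show ?thesis .
qed

text \<open>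
  The eigenvalue of a single step of the walk on \<open>\<int>\<^sub>p\<close> at the character of
  frequency \<open>j\<close>.
\<close>
definition increment_char :: "walk \<Rightarrow> nat \<Rightarrow> int \<Rightarrow> complex" where
  "increment_char w p j = measure_pmf.expectation (increment w) (\<lambda>s. root_char p (j * s))"

lemma increment_char_simps:
  "increment_char Simple p j = complex_of_real (cos (2 * pi * of_int j / of_nat p))"
  "increment_char Directed p j = root_char p j"
proof -
  have two_point: "measure_pmf.expectation (pmf_of_set {-1, 1 :: int}) f = (f (-1) + f 1) / 2"
    for f :: "int \<Rightarrow> complex"
    by (subst integral_measure_pmf[of "{-1, 1}"]) (auto simp: scaleR_conv_of_real add_divide_distrib)
  show "increment_char Simple p j = complex_of_real (cos (2 * pi * of_int j / of_nat p))"
    unfolding increment_char_def increment.simps two_point by (simp add: root_char_def complex_eq_iff)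
qed (simp add: increment_char_def)

text \<open>
  The drift of the directed walk only enters the imaginary part. All bounds below use the moduli
  of the multipliers, which depend on the real part alone, and so they hold for both walks.
\<close>
lemma Re_increment_char: "Re (increment_char w p j) = cos (2 * pi * of_int j / of_nat p)"
  by (cases w) (simp_all add: increment_char_simps root_char_def)

text \<open>
  The representatives of \<open>\<int>\<^sub>p\<^sup>k\<close>; they contain the support of every
  law considered here.
\<close>
definition torus :: "nat \<Rightarrow> nat \<Rightarrow> (nat \<Rightarrow> int) set" where
  "torus p k = {x. (\<forall>i<k. 0 \<le> x i \<and> x i < int p) \<and> (\<forall>i\<ge>k. x i = 0)}"

lemma finite_torus [simp]: "finite (torus p k)"
proof -
  have "inj_on (\<lambda>x. restrict x {..<k}) (torus p k)"
    by (auto simp: inj_on_def torus_def fun_eq_iff restrict_def) (metis not_le)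
  moreover have "(\<lambda>x. restrict x {..<k}) ` torus p k \<subseteq> {..<k} \<rightarrow>\<^sub>E {0..<int p}"
    by (auto simp: torus_def PiE_def extensional_def)
  ultimately show ?thesis
    by (meson finite_PiE finite_atLeastLessThan_int finite_imageD finite_lessThan finite_subset)
qed

lemma set_pmf_jump_chain:
  assumes "p > 0" "k > 0"
  shows "set_pmf (jump_chain w p k n) \<subseteq> torus p k"
proof (induction n)
  case 0
  then show ?case using assms by (auto simp: torus_def)
next
  case (Suc n)
  have "set_pmf (pmf_of_set {..<k}) = {..<k}"
    using assms by (intro set_pmf_of_set) auto
  then have "set_pmf (walk_step w p k x) \<subseteq> torus p k" if "x \<in> torus p k" for x
    using that assms by (auto simp: walk_step_def torus_def)
  then show ?case using Suc by fastforce
qed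

lemma set_pmf_walk_law:
  assumes "p > 0" "k > 0"
  shows "set_pmf (walk_law w p k t) \<subseteq> torus p k"
  using set_pmf_jump_chain[OF assms, of w] set_pmf_jump_chain[OF assms, of w 0]
  unfolding walk_law_def by auto

text \<open>
  A character of \<open>\<int>\<^sub>p\<^sup>k\<close> is an eigenfunction of the step: changing
  coordinate \<open>i\<close> multiplies it by the character of the increment in that coordinate,
  and \<open>i\<close> is uniform.
\<close>
lemma expectation_walk_step_char:
  assumes "k > 0"
  shows "measure_pmf.expectation (walk_step w p k x) (\<lambda>y. \<Prod>i<k. root_char p (J i * y i))
       = ((\<Sum>i<k. increment_char w p (J i)) / of_nat k) * (\<Prod>i<k. root_char p (J i * x i))"
proof -
  have fin: "finite (set_pmf (increment w))" by (cases w) auto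
  have ne: "{..<k} \<noteq> {}" using assms by auto
  have upd: "(\<Prod>l<k. root_char p (J l * (x(i := (x i + s) mod int p)) l))
      = root_char p (J i * s) * (\<Prod>l<k. root_char p (J l * x l))" if "i < k" for i s
  proof -
    have "(\<Prod>l<k. root_char p (J l * (x(i := (x i + s) mod int p)) l))
        = (\<Prod>l<k. (if l = i then root_char p (J i * s) else 1) * root_char p (J l * x l))"
      by (rule prod.cong) (auto simp: root_char_mod distrib_left root_char_add)
    also have "\<dots> = root_char p (J i * s) * (\<Prod>l<k. root_char p (J l * x l))"
      using that by (simp add: prod.distrib)
    finally show ?thesis .
  qed
  have "measure_pmf.expectation (walk_step w p k x) (\<lambda>y. \<Prod>i<k. root_char p (J i * y i))
      = (\<Sum>i<k. measure_pmf.expectation (increment w)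
            (\<lambda>s. \<Prod>l<k. root_char p (J l * (x(i := (x i + s) mod int p)) l)) /\<^sub>R real k)"
    unfolding walk_step_def
    using ne fin by (subst pmf_expectation_bind_pmf_of_set) (auto simp: )
  also have "\<dots> = (\<Sum>i<k. increment_char w p (J i) * (\<Prod>l<k. root_char p (J l * x l)) /\<^sub>R real k)"
    by (intro sum.cong refl) (simp only: upd lessThan_iff increment_char_def integral_mult_left_zero)
  also have "\<dots> = ((\<Sum>i<k. increment_char w p (J i)) / of_nat k) * (\<Prod>i<k. root_char p (J i * x i))"
    unfolding sum_divide_distrib sum_distrib_right
    by (intro sum.cong refl) (simp add: scaleR_conv_of_real divide_simps)
  finally show ?thesis .
qed

lemma expectation_jump_chain_char:
  assumes "p > 0" "k > 0"
  shows "measure_pmf.expectation (jump_chain w p k n) (\<lambda>y. \<Prod>i<k. root_char p (J i * y i))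
       = ((\<Sum>i<k. increment_char w p (J i)) / of_nat k) ^ n"
proof (induction n)
  case (Suc n)
  let ?A = "torus p k"
  let ?z = "(\<Sum>i<k. increment_char w p (J i)) / of_nat k"
  have "set_pmf (pmf_of_set {..<k}) = {..<k}"
    using assms by (intro set_pmf_of_set) auto
  then have fin: "finite (set_pmf (walk_step w p k x))" for x
    by (cases w) (auto simp: walk_step_def)
  have "measure_pmf.expectation (jump_chain w p k (Suc n)) (\<lambda>y. \<Prod>i<k. root_char p (J i * y i))
     = (\<Sum>x\<in>?A. pmf (jump_chain w p k n) x *\<^sub>R
          (?z * (\<Prod>i<k. root_char p (J i * x i))))"
    using fin set_pmf_jump_chain[OF assms]
    by (simp add: pmf_expectation_bind[where A = ?A] expectation_walk_step_char[OF assms(2)])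
  also have "\<dots> = ?z * (\<Sum>x\<in>?A. pmf (jump_chain w p k n) x *\<^sub>R (\<Prod>i<k. root_char p (J i * x i)))"
    by (simp add: sum_distrib_left)
  also have "(\<Sum>x\<in>?A. pmf (jump_chain w p k n) x *\<^sub>R (\<Prod>i<k. root_char p (J i * x i))) = ?z ^ n"
    using Suc by (subst (asm) integral_measure_pmf[where A = ?A])
      (use set_pmf_jump_chain[OF assms] in auto)
  finally show ?case by simp
qed simp


text \<open>
  Fourier inversion on \<open>\<int>\<^sub>p\<^sup>k\<close>: the indicator of \<open>y =
  x\<close> is a product over the coordinates of averages of characters, and expanding this
  product gives one term for each frequency vector \<open>J\<close>.
\<close>
lemma pmf_fourier:
  assumes "p > 0" "set_pmf M \<subseteq> torus p k" "x \<in> torus p k"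
  shows "complex_of_real (pmf M x) = (1 / of_nat p) ^ k *
    (\<Sum>J\<in>{..<k} \<rightarrow>\<^sub>E {0..<int p}.
        measure_pmf.expectation M (\<lambda>y. \<Prod>i<k. root_char p (J i * y i)) * (\<Prod>i<k. root_char p (- J i * x i)))"
proof -
  let ?P = "{..<k} \<rightarrow>\<^sub>E {0..<int p}" and ?T = "torus p k"
  have indicator: "(1 / of_nat p) ^ k * (\<Sum>J\<in>?P. (\<Prod>i<k. root_char p (J i * y i)) * (\<Prod>i<k. root_char p (- J i * x i)))
      = of_bool (y = x)" if "y \<in> ?T" for y
  proof -
    have "(\<Sum>J\<in>?P. (\<Prod>i<k. root_char p (J i * y i)) * (\<Prod>i<k. root_char p (- J i * x i)))
        = (\<Sum>J\<in>?P. \<Prod>i<k. root_char p (J i * (y i - x i)))"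
      by (simp add: prod.distrib[symmetric] root_char_add[symmetric] right_diff_distrib)
    also have "\<dots> = (\<Prod>i<k. \<Sum>j\<in>{0..<int p}. root_char p (j * (y i - x i)))"
      by (subst prod_sum_PiE) auto
    also have "\<dots> = (\<Prod>i<k. of_nat p * of_bool (y i = x i))"
    proof (intro prod.cong refl)
      fix i assume "i \<in> {..<k}"
      then have "0 \<le> y i" "y i < int p" "0 \<le> x i" "x i < int p"
        using that assms(3) by (auto simp: torus_def)
      then have "int p dvd y i - x i \<longleftrightarrow> y i = x i"
        by (metis mod_eq_dvd_iff mod_pos_pos_trivial)
      then show "(\<Sum>j\<in>{0..<int p}. root_char p (j * (y i - x i))) = of_nat p * of_bool (y i = x i)"
        using assms(1) by (simp add: sum_root_char)
    qed
    also have "\<dots> = of_nat p ^ k * of_bool (\<forall>i<k. y i = x i)"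
      by (auto simp: prod.distrib)
    also have "(\<forall>i<k. y i = x i) \<longleftrightarrow> y = x"
      using that assms(3) unfolding torus_def fun_eq_iff mem_Collect_eq by (metis not_le)
    finally show ?thesis using assms(1) by (simp add: power_divide)
  qed
  have "complex_of_real (pmf M x) = (\<Sum>y\<in>?T. pmf M y *\<^sub>R of_bool (y = x))"
    using assms(3) by (simp add: scaleR_conv_of_real sum.remove[where x = x])
  also have "\<dots> = (\<Sum>y\<in>?T. \<Sum>J\<in>?P. (1 / of_nat p) ^ k *
      ((pmf M y *\<^sub>R (\<Prod>i<k. root_char p (J i * y i))) * (\<Prod>i<k. root_char p (- J i * x i))))"
    by (intro sum.cong refl, subst indicator[symmetric])
      (simp_all add: sum_distrib_left scaleR_sum_right)
  also have "\<dots> = (1 / of_nat p) ^ k * (\<Sum>J\<in>?P.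
      (\<Sum>y\<in>?T. pmf M y *\<^sub>R (\<Prod>i<k. root_char p (J i * y i))) * (\<Prod>i<k. root_char p (- J i * x i)))"
    by (subst sum.swap) (simp only: sum_distrib_left[symmetric] sum_distrib_right[symmetric])
  also have "(\<lambda>J. \<Sum>y\<in>?T. pmf M y *\<^sub>R (\<Prod>i<k. root_char p (J i * y i)))
      = (\<lambda>J. measure_pmf.expectation M (\<lambda>y. \<Prod>i<k. root_char p (J i * y i)))"
    using assms(2) by (intro ext, subst integral_measure_pmf[where A = ?T]) auto
  finally show ?thesis .
qed

definition fourier_series :: "nat \<Rightarrow> (int \<Rightarrow> complex) \<Rightarrow> int \<Rightarrow> complex" where
  "fourier_series p a x = (1 / of_nat p) * (\<Sum>j\<in>{0..<int p}. a j * root_char p (- j * x))"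

text \<open>
  The Fourier coefficient at frequency \<open>j\<close> of the rate-1 walk on
  \<open>\<int>\<^sub>p\<close> at time \<open>s\<close>.
\<close>
definition multiplier :: "walk \<Rightarrow> nat \<Rightarrow> real \<Rightarrow> int \<Rightarrow> complex" where
  "multiplier w p s j = exp (of_real s * (increment_char w p j - 1))"

lemma poisson_generating_function:
  fixes z :: complex
  assumes "t > 0"
  shows "(\<lambda>n. of_real (pmf (poisson_pmf t) n) * z ^ n) sums exp (of_real t * (z - 1))"
proof -
  have "(\<lambda>n. exp (- of_real t) * ((of_real t * z) ^ n /\<^sub>R fact n)) sums (exp (- of_real t) * exp (of_real t * z))"
    by (intro sums_mult exp_converges)
  also have "exp (- of_real t) * exp (of_real t * z) = exp (of_real t * (z - 1))"
    by (simp add: exp_add[symmetric] algebra_simps)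
  also have "(\<lambda>n. exp (- of_real t) * ((of_real t * z) ^ n /\<^sub>R fact n))
      = (\<lambda>n. of_real (pmf (poisson_pmf t) n) * z ^ n)"
    using assms by (simp add: fun_eq_iff scaleR_conv_of_real power_mult_distrib exp_of_real[symmetric] divide_simps mult_ac)
  finally show ?thesis .
qed

lemma pmf_bind_nat_sums:
  fixes N :: "nat pmf"
  shows "(\<lambda>n. pmf N n * pmf (f n) x) sums pmf (bind_pmf N f) x"
proof -
  have "Infinite_Set_Sum.abs_summable_on (\<lambda>n. pmf N n * pmf (f n) x) UNIV"
  proof (rule abs_summable_on_comparison_test[OF pmf_abs_summable[of N UNIV]])
    show "norm (pmf N n * pmf (f n) x) \<le> norm (pmf N n)" for n
      by (simp add: mult_left_le pmf_le_1)
  qed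
  from sums_infsetsum_nat[OF this] show ?thesis
    by (simp add: pmf_bind pmf_expectation_eq_infsetsum)
qed

text \<open>
  The walk at time \<open>t\<close> has the Fourier coefficient \<open>exp (t (\<lambda> -
  1))\<close>, where \<open>\<lambda>\<close> is the average of the eigenvalues of the
  coordinates. An exponential of a sum is a product over the coordinates, and therefore so is the
  law. This is where the Poisson number of jumps is used.
\<close>
lemma pmf_walk_law:
  assumes "p > 0" "k > 0" "t \<ge> 0" "x \<in> torus p k"
  shows "complex_of_real (pmf (walk_law w p k t) x) = (\<Prod>i<k. fourier_series p (multiplier w p (t / k)) (x i))"
proof -
  let ?P = "{..<k} \<rightarrow>\<^sub>E {0..<int p}"
  define z where "z J = (\<Sum>i<k. increment_char w p (J i)) / of_nat k" for J
  define e where "e J = (\<Prod>i<k. root_char p (- J i * x i))" for J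
  have chain: "complex_of_real (pmf (jump_chain w p k n) x) = (1 / of_nat p) ^ k * (\<Sum>J\<in>?P. z J ^ n * e J)" for n
    using assms by (subst pmf_fourier[OF _ set_pmf_jump_chain])
      (simp_all add: expectation_jump_chain_char z_def e_def)
  have law: "complex_of_real (pmf (walk_law w p k t) x)
      = (1 / of_nat p) ^ k * (\<Sum>J\<in>?P. exp (of_real t * (z J - 1)) * e J)"
  proof (cases "t = 0")
    case True
    then show ?thesis using chain[of 0] by (simp add: walk_law_def)
  next
    case False
    then have t: "t > 0" using assms(3) by simp
    have "(\<lambda>n. complex_of_real (pmf (poisson_pmf t) n * pmf (jump_chain w p k n) x))
        sums complex_of_real (pmf (walk_law w p k t) x)"
      using False pmf_bind_nat_sums[of "poisson_pmf t" "jump_chain w p k" x]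
      by (simp only: sums_of_real_iff walk_law_def if_False)
    also have "(\<lambda>n. complex_of_real (pmf (poisson_pmf t) n * pmf (jump_chain w p k n) x))
        = (\<lambda>n. (1 / of_nat p) ^ k * (\<Sum>J\<in>?P. (of_real (pmf (poisson_pmf t) n) * z J ^ n) * e J))"
      by (rule ext) (simp only: of_real_mult chain mult.assoc mult.left_commute sum_distrib_left)
    finally show ?thesis
    proof (rule sums_unique2)
      show "(\<lambda>n. (1 / of_nat p) ^ k * (\<Sum>J\<in>?P. (of_real (pmf (poisson_pmf t) n) * z J ^ n) * e J))
          sums ((1 / of_nat p) ^ k * (\<Sum>J\<in>?P. exp (of_real t * (z J - 1)) * e J))"
        by (intro sums_mult sums_sum sums_mult2 poisson_generating_function t)
    qed
  qed
  have "exp (of_real t * (z J - 1)) * e J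
      = (\<Prod>i<k. exp (of_real (t / k) * (increment_char w p (J i) - 1)) * root_char p (- J i * x i))" for J
  proof -
    have "of_real t * (z J - 1) = (\<Sum>i<k. of_real (t / k) * (increment_char w p (J i) - 1))"
      using assms(2) unfolding z_def sum_distrib_left[symmetric] sum_subtractf
      by (simp add: right_diff_distrib)
    then show ?thesis by (simp only: exp_sum finite_lessThan prod.distrib e_def)
  qed
  then have "(\<Sum>J\<in>?P. exp (of_real t * (z J - 1)) * e J)
     = (\<Prod>i<k. \<Sum>j\<in>{0..<int p}. exp (of_real (t / k) * (increment_char w p j - 1)) * root_char p (- j * x i))"
    by (subst prod_sum_PiE) auto
  then show ?thesis
    unfolding law fourier_series_def multiplier_def prod.distrib by (simp add: prod_constant)
qed

text \<open>
  The walk with a single coordinate is the walk on \<open>\<int>\<^sub>p\<close>. Taking its law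
  from the case \<open>k = 1\<close> makes it nonnegative and of total mass \<open>1\<close> by
  construction, which the Fourier formula would not show.
\<close>
definition coord_pmf :: "walk \<Rightarrow> nat \<Rightarrow> real \<Rightarrow> int pmf" where
  "coord_pmf w p s = map_pmf (\<lambda>x. x 0) (walk_law w p 1 s)"

lemma set_pmf_coord_pmf:
  assumes "p > 0"
  shows "set_pmf (coord_pmf w p s) \<subseteq> {0..<int p}"
  using set_pmf_walk_law[OF assms, of 1] by (fastforce simp: coord_pmf_def torus_def)

lemma pmf_coord_pmf:
  assumes "p > 0" "s \<ge> 0" "x \<in> {0..<int p}"
  shows "complex_of_real (pmf (coord_pmf w p s) x) = fourier_series p (multiplier w p s) x"
proof -
  let ?x = "\<lambda>i::nat. if i = 0 then x else 0"
  have x: "?x \<in> torus p 1" using assms by (auto simp: torus_def)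
  have inj: "inj_on (\<lambda>y. y 0) (torus p 1)"
    by (rule inj_onI, rule ext, case_tac "xa = 0") (auto simp: torus_def)
  have "pmf (coord_pmf w p s) x = pmf (walk_law w p 1 s) ?x"
  proof (cases "?x \<in> set_pmf (walk_law w p 1 s)")
    case True
    have "inj_on (\<lambda>y. y 0) (set_pmf (walk_law w p 1 s))"
      using inj set_pmf_walk_law[OF assms(1), of 1] by (meson inj_on_subset zero_less_one)
    from pmf_map_inj[OF this True] show ?thesis by (simp add: coord_pmf_def)
  next
    case False
    have "x \<notin> set_pmf (coord_pmf w p s)"
    proof
      assume "x \<in> set_pmf (coord_pmf w p s)"
      then obtain y where y: "y \<in> set_pmf (walk_law w p 1 s)" "y 0 = x"
        by (auto simp: coord_pmf_def)
      then have "y \<in> torus p 1" using set_pmf_walk_law[OF assms(1), of 1] by auto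
      then have "y = ?x" using inj_onD[OF inj, of y ?x] x y by simp
      then show False using y False by simp
    qed
    then show ?thesis using False by (simp add: set_pmf_iff)
  qed
  then show ?thesis using pmf_walk_law[OF assms(1) _ assms(2) x] by simp
qed

lemma walk_law_eq_Pi_pmf:
  assumes "p > 0" "k > 0" "t \<ge> 0"
  shows "walk_law w p k t = Pi_pmf {..<k} 0 (\<lambda>_. coord_pmf w p (t / k))"
proof (rule pmf_eqI)
  fix x
  show "pmf (walk_law w p k t) x = pmf (Pi_pmf {..<k} 0 (\<lambda>_. coord_pmf w p (t / k))) x"
  proof (cases "x \<in> torus p k")
    case True
    have "complex_of_real (pmf (walk_law w p k t) x) = complex_of_real (\<Prod>i<k. pmf (coord_pmf w p (t / k)) (x i))"
      using assms True by (simp add: pmf_walk_law) (auto simp: pmf_coord_pmf torus_def intro!: prod.cong)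
    then have "pmf (walk_law w p k t) x = (\<Prod>i<k. pmf (coord_pmf w p (t / k)) (x i))"
      by (simp only: of_real_eq_iff)
    then show ?thesis using True by (auto simp: pmf_Pi torus_def)
  next
    case False
    have "pmf (walk_law w p k t) x = 0"
      using False set_pmf_walk_law[OF assms(1,2), of w t] by (meson pmf_eq_0_set_pmf subsetD)
    moreover have "pmf (Pi_pmf {..<k} 0 (\<lambda>_. coord_pmf w p (t / k))) x = 0"
    proof (cases "\<forall>i. i \<notin> {..<k} \<longrightarrow> x i = 0")
      case True
      then obtain i where "i < k" "x i \<notin> {0..<int p}" using False by (auto simp: torus_def)
      then have "pmf (coord_pmf w p (t / k)) (x i) = 0"
        using set_pmf_coord_pmf[OF assms(1), of w "t / k"] by (meson pmf_eq_0_set_pmf subsetD)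
      then show ?thesis using \<open>i < k\<close> by (auto simp: pmf_Pi)
    qed (auto simp: pmf_Pi)
    ultimately show ?thesis by simp
  qed
qed

text \<open>
  Entropy is additive over independent coordinates.
\<close>
lemma walk_entropy_eq:
  assumes "p > 0" "k > 0" "t \<ge> 0"
  shows "walk_entropy w p k t = real k * shannon_entropy (coord_pmf w p (t / k))"
proof -
  let ?c = "coord_pmf w p (t / k)"
  let ?P = "Pi_pmf {..<k} 0 (\<lambda>_. ?c)"
  have finP: "finite (set_pmf ?P)"
    using finite_subset[OF set_pmf_walk_law[OF assms(1,2)] finite_torus, of w t]
    by (simp add: walk_law_eq_Pi_pmf[OF assms])
  have "walk_entropy w p k t = measure_pmf.expectation ?P (\<lambda>x. - ln (pmf ?P x))"
    by (simp only: walk_entropy_def walk_law_eq_Pi_pmf[OF assms] shannon_entropy_eq_expectation)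
  also have "\<dots> = measure_pmf.expectation ?P (\<lambda>x. \<Sum>i<k. - ln (pmf ?c (x i)))"
  proof (intro integral_cong_AE)
    show "AE x in ?P. - ln (pmf ?P x) = (\<Sum>i<k. - ln (pmf ?c (x i)))"
    proof (rule AE_pmfI)
      fix x assume x: "x \<in> set_pmf ?P"
      then have "pmf ?P x \<noteq> 0" by (simp add: set_pmf_iff)
      then have eq: "pmf ?P x = (\<Prod>i<k. pmf ?c (x i))" and "(\<Prod>i<k. pmf ?c (x i)) \<noteq> 0"
        by (auto simp: pmf_Pi split: if_splits)
      then have nz: "pmf ?c (x i) \<noteq> 0" if "i < k" for i
        using that by simp
      then show "- ln (pmf ?P x) = (\<Sum>i<k. - ln (pmf ?c (x i)))"
        unfolding eq by (subst ln_prod) (simp_all add: sum_negf nz)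
    qed
  qed simp_all
  also have "\<dots> = (\<Sum>i<k. measure_pmf.expectation ?P (\<lambda>x. - ln (pmf ?c (x i))))"
    by (intro Bochner_Integration.integral_sum integrable_measure_pmf_finite finP)
  also have "\<dots> = (\<Sum>i<k. shannon_entropy ?c)"
  proof (rule sum.cong[OF refl])
    fix i assume "i \<in> {..<k}"
    have "measure_pmf.expectation ?P (\<lambda>x. - ln (pmf ?c (x i)))
        = measure_pmf.expectation (map_pmf (\<lambda>x. x i) ?P) (\<lambda>x. - ln (pmf ?c x))" by simp
    also have "map_pmf (\<lambda>x. x i) ?P = ?c"
      using \<open>i \<in> {..<k}\<close> by (subst Pi_pmf_component) auto
    finally show "measure_pmf.expectation ?P (\<lambda>x. - ln (pmf ?c (x i))) = shannon_entropy ?c"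
      by (simp only: shannon_entropy_eq_expectation)
  qed
  finally show ?thesis by simp
qed


section \<open>Entropy of densities on the cyclic group\<close>

text \<open>
  Functions on \<open>\<int>\<^sub>p\<close> are represented by periodic functions on the
  integers, so that shifts and reflections need no reduction modulo \<open>p\<close>.
\<close>
definition periodic :: "nat \<Rightarrow> (int \<Rightarrow> 'a) \<Rightarrow> bool" where
  "periodic p f \<longleftrightarrow> (\<forall>x. f (x mod int p) = f x)"

lemma periodic_cong:
  assumes "periodic p f" "x mod int p = y mod int p"
  shows "f x = f y"
  using assms unfolding periodic_def by metis

lemma sum_periodic_shift:
  fixes f :: "int \<Rightarrow> 'a::comm_monoid_add"
  assumes "p > 0" "periodic p f"
  shows "(\<Sum>x\<in>{0..<int p}. f (x + a)) = (\<Sum>x\<in>{0..<int p}. f x)"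
proof (rule sum.reindex_bij_witness[of _ "\<lambda>x. (x - a) mod int p" "\<lambda>x. (x + a) mod int p"])
  fix x assume "x \<in> {0..<int p}"
  then show "((x + a) mod int p - a) mod int p = x" "((x - a) mod int p + a) mod int p = x"
    by (simp_all add: mod_diff_left_eq mod_add_left_eq)
  show "f ((x + a) mod int p) = f (x + a)"
    using assms(2) by (simp add: periodic_def)
qed (use assms in auto)

lemma sum_periodic_reflect:
  fixes f :: "int \<Rightarrow> 'a::comm_monoid_add"
  assumes "p > 0" "periodic p f"
  shows "(\<Sum>x\<in>{0..<int p}. f (a - x)) = (\<Sum>x\<in>{0..<int p}. f x)"
proof (rule sum.reindex_bij_witness[of _ "\<lambda>x. (a - x) mod int p" "\<lambda>x. (a - x) mod int p"])
  fix x assume "x \<in> {0..<int p}"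
  then show "(a - (a - x) mod int p) mod int p = x" "(a - (a - x) mod int p) mod int p = x"
    by (simp_all add: mod_diff_right_eq)
  show "f ((a - x) mod int p) = f (a - x)"
    using assms(2) by (simp add: periodic_def)
qed (use assms in auto)

definition prob_density :: "nat \<Rightarrow> (int \<Rightarrow> real) \<Rightarrow> bool" where
  "prob_density p f \<longleftrightarrow> periodic p f \<and> (\<forall>x. 0 \<le> f x) \<and> (\<Sum>x\<in>{0..<int p}. f x) = 1"

lemma prob_densityD:
  assumes "prob_density p f"
  shows "periodic p f" "0 \<le> f x" "(\<Sum>x\<in>{0..<int p}. f x) = 1"
  using assms by (auto simp: prob_density_def)

definition cyclic_conv :: "nat \<Rightarrow> (int \<Rightarrow> real) \<Rightarrow> (int \<Rightarrow> real) \<Rightarrow> int \<Rightarrow> real" where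
  "cyclic_conv p f g x = (\<Sum>y\<in>{0..<int p}. g y * f (x - y))"

lemma periodic_cyclic_conv:
  assumes "periodic p f" shows "periodic p (cyclic_conv p f g)"
  using periodic_cong[OF assms] unfolding periodic_def cyclic_conv_def
  by (intro allI sum.cong refl) (metis mod_diff_left_eq)

lemma prob_density_conv:
  assumes "p > 0" "prob_density p f" "prob_density p g"
  shows "prob_density p (cyclic_conv p f g)"
proof -
  have "(\<Sum>x\<in>{0..<int p}. cyclic_conv p f g x)
      = (\<Sum>y\<in>{0..<int p}. \<Sum>x\<in>{0..<int p}. g y * f (x + (- y)))"
    unfolding cyclic_conv_def by (subst sum.swap) simp
  also have "\<dots> = (\<Sum>y\<in>{0..<int p}. g y * (\<Sum>x\<in>{0..<int p}. f x))"
    unfolding sum_distrib_left[symmetric]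
    using assms by (intro sum.cong refl arg_cong2[where f = "(*)"] sum_periodic_shift)
      (auto simp: prob_density_def)
  finally show ?thesis
    using assms by (auto simp: prob_density_def periodic_cyclic_conv) (auto simp: cyclic_conv_def intro!: sum_nonneg)
qed

definition density_entropy :: "nat \<Rightarrow> (int \<Rightarrow> real) \<Rightarrow> real" where
  "density_entropy p f = (\<Sum>x\<in>{0..<int p}. - f x * ln (f x))"

text \<open>
  The inequality \<open>ln r \<le> r - 1\<close> in the form in which it enters the entropy
  inequalities.
\<close>
lemma ln_le_ratio:
  assumes "0 < (x::real)" "0 < y"
  shows "x * (ln y - ln x) \<le> y - x"
proof -
  have "ln (y / x) \<le> y / x - 1" using assms by (intro ln_le_minus_one) auto
  then have "x * ln (y / x) \<le> x * (y / x - 1)" using assms by (intro mult_left_mono) auto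
  also have "x * (y / x - 1) = y - x" using assms by (simp add: right_diff_distrib)
  finally show ?thesis using assms by (simp add: ln_div)
qed

text \<open>
  Nonnegativity of relative entropy. Each choice of a reference \<open>r\<close> gives an upper
  bound on the entropy; the Fourier bound and the mean distance bound below come from suitable
  choices.
\<close>
lemma gibbs_inequality:
  assumes "prob_density p f" "\<And>x. 0 < r x" "(\<Sum>x\<in>{0..<int p}. r x) \<le> 1"
  shows "density_entropy p f \<le> (\<Sum>x\<in>{0..<int p}. - f x * ln (r x))"
proof -
  have "f x * (ln (r x) - ln (f x)) \<le> r x - f x" for x
  proof (cases "f x = 0")
    case True
    then show ?thesis using assms(2)[of x] by simp
  next
    case False
    then show ?thesis using ln_le_ratio[of "f x" "r x"] assms(2)[of x] prob_densityD(2)[OF assms(1), of x] by simp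
  qed
  then have "(\<Sum>x\<in>{0..<int p}. f x * (ln (r x) - ln (f x))) \<le> (\<Sum>x\<in>{0..<int p}. r x - f x)"
    by (intro sum_mono)
  also have "\<dots> \<le> 0"
    using assms(3) prob_densityD(3)[OF assms(1)] by (simp add: sum_subtractf)
  finally show ?thesis
    by (simp add: density_entropy_def algebra_simps sum_subtractf sum_negf)
qed

lemma density_entropy_ge_max:
  assumes "prob_density p f" "\<And>x. f x \<le> m" "0 < m"
  shows "- ln m \<le> density_entropy p f"
proof -
  have "f x * - ln m \<le> - f x * ln (f x)" for x
  proof (cases "f x = 0")
    case False
    then have "0 < f x" using prob_densityD(2)[OF assms(1), of x] by simp
    then show ?thesis using assms(2)[of x] by (simp add: assms(3))
  qed simp
  then have "(\<Sum>x\<in>{0..<int p}. f x * - ln m) \<le> density_entropy p f"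
    unfolding density_entropy_def by (intro sum_mono)
  then show ?thesis using prob_densityD(3)[OF assms(1)] by (simp add: sum_distrib_right[symmetric] sum_negf)
qed

text \<open>
  The tangent at \<open>x > 0\<close> lies above the graph on all of \<open>[0,
  \<infinity>)\<close>, including \<open>0\<close>; evaluating it at the weighted mean gives
  concavity.
\<close>
lemma concave_entropy_fun: "concave_on {0..} (\<lambda>x::real. - x * ln x)"
proof -
  have tangent: "- y * ln y \<le> - x * ln x + (- ln x - 1) * (y - x)" if "0 < x" "0 \<le> y" for x y :: real
  proof (cases "y = 0")
    case False
    then have "y * (ln x - ln y) \<le> x - y" using that by (intro ln_le_ratio) auto
    then show ?thesis by (simp add: algebra_simps)
  qed (use that in \<open>simp add: algebra_simps\<close>)
  have "- (u * x + v * y) * ln (u * x + v * y) \<ge> u * (- x * ln x) + v * (- y * ln y)"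
    if "0 \<le> x" "0 \<le> y" "0 < u" "0 < v" "u + v = 1" for x y u v :: real
  proof (cases "u * x + v * y = 0")
    case True
    then have "x = 0" "y = 0"
      using that by (auto simp: add_nonneg_eq_0_iff)
    then show ?thesis by simp
  next
    case False
    define m where "m = u * x + v * y"
    have m: "0 < m" using False that by (simp add: m_def less_le)
    have "u * (- x * ln x) + v * (- y * ln y)
        \<le> u * (- m * ln m + (- ln m - 1) * (x - m)) + v * (- m * ln m + (- ln m - 1) * (y - m))"
      using that m by (intro add_mono mult_left_mono tangent) auto
    also have "\<dots> = (u + v) * (- m * ln m) + (- ln m - 1) * (m - (u + v) * m)"
      by (simp add: m_def algebra_simps)
    also have "\<dots> = - m * ln m" using that by simp
    finally show ?thesis by (simp add: m_def)
  qed
  note key = this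
  have "- (- ((1 - t) * x + t * y) * ln ((1 - t) * x + t * y)) \<le> (1 - t) * - (- x * ln x) + t * - (- y * ln y)"
    if "0 \<le> x" "0 \<le> y" "0 < t" "t < 1" for x y t :: real
    using key[of x y "1 - t" t] that by simp
  then show ?thesis
    unfolding concave_on_def by (intro convex_onI) simp_all
qed

text \<open>
  Jensen's inequality: a convolution is an average of translates, and these all have the entropy
  of \<open>f\<close>.
\<close>
lemma density_entropy_conv_ge:
  assumes "p > 0" "prob_density p f" "prob_density p g"
  shows "density_entropy p f \<le> density_entropy p (cyclic_conv p f g)"
proof -
  let ?Z = "{0..<int p}"
  have per: "periodic p (\<lambda>x. - f x * ln (f x))"
    using prob_densityD(1)[OF assms(2)] by (simp add: periodic_def)
  have "(\<Sum>y\<in>?Z. g y * (- f (x - y) * ln (f (x - y)))) \<le> - cyclic_conv p f g x * ln (cyclic_conv p f g x)" for x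
    using concave_on_sum[OF _ _ concave_entropy_fun, of ?Z g "\<lambda>y. f (x - y)"] assms
    by (auto simp: cyclic_conv_def prob_density_def)
  then have "(\<Sum>x\<in>?Z. \<Sum>y\<in>?Z. g y * (- f (x + (- y)) * ln (f (x + (- y))))) \<le> density_entropy p (cyclic_conv p f g)"
    unfolding density_entropy_def by (intro sum_mono) simp
  also have "(\<Sum>x\<in>?Z. \<Sum>y\<in>?Z. g y * (- f (x + (- y)) * ln (f (x + (- y)))))
      = (\<Sum>y\<in>?Z. g y * density_entropy p f)"
    by (subst sum.swap)
      (simp only: sum_distrib_left[symmetric] sum_periodic_shift[OF assms(1) per] density_entropy_def)
  also have "\<dots> = density_entropy p f"
    using prob_densityD(3)[OF assms(3)] by (simp add: sum_distrib_right[symmetric])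
  finally show ?thesis .
qed

text \<open>
  A Doeblin argument: if \<open>g\<close> dominates half of the uniform density, then convolving
  with \<open>g\<close> mixes, with equal weights, the uniform density and a convolution of
  \<open>f\<close>. By concavity the gap to \<open>ln p\<close> is at least halved.
\<close>
lemma density_entropy_conv_halfway:
  assumes "p > 0" "prob_density p f" "prob_density p g" "\<And>x. 1 / (2 * p) \<le> g x"
  shows "ln p - density_entropy p (cyclic_conv p f g) \<le> (ln p - density_entropy p f) / 2"
proof -
  let ?Z = "{0..<int p}"
  \<comment> \<open>The density with \<open>g = (1 / 2) (1 / p) + (1 / 2) r\<close>.\<close>
  define r where "r x = 2 * g x - 1 / p" for x
  have r: "prob_density p r"
    unfolding prob_density_def
  proof (intro conjI allI)
    show "periodic p r" using prob_densityD(1)[OF assms(3)] by (simp add: periodic_def r_def)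
    show "0 \<le> r x" for x using assms(4)[of x] by (simp add: r_def)
    show "(\<Sum>x\<in>?Z. r x) = 1"
      using prob_densityD(3)[OF assms(3)] assms(1)
      by (simp add: r_def sum_subtractf sum_distrib_left[symmetric])
  qed
  have cr: "prob_density p (cyclic_conv p f r)" using assms r by (intro prob_density_conv)
  have split: "cyclic_conv p f g x = (1/2) * (1 / p) + (1/2) * cyclic_conv p f r x" for x
  proof -
    have "(\<Sum>y\<in>?Z. f (x - y)) = 1"
      using sum_periodic_reflect[OF assms(1) prob_densityD(1)[OF assms(2)]] prob_densityD(3)[OF assms(2)] by simp
    moreover have "cyclic_conv p f r x = 2 * cyclic_conv p f g x - (\<Sum>y\<in>?Z. f (x - y)) / p"
      by (simp add: cyclic_conv_def r_def left_diff_distrib sum_subtractf sum_distrib_left sum_divide_distrib mult.assoc)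
    ultimately show ?thesis using assms(1) by (simp add: field_simps)
  qed
  have "(1/2) * (- (1 / p) * ln (1 / p)) + (1/2) * (- cyclic_conv p f r x * ln (cyclic_conv p f r x))
       \<le> - cyclic_conv p f g x * ln (cyclic_conv p f g x)" for x
    using concave_onD[OF concave_entropy_fun, of "1/2" "1 / real p" "cyclic_conv p f r x"] prob_densityD(2)[OF cr, of x]
    by (simp add: split)
  then have "(\<Sum>x\<in>?Z. (1/2) * (- (1 / p) * ln (1 / p)) + (1/2) * (- cyclic_conv p f r x * ln (cyclic_conv p f r x)))
     \<le> density_entropy p (cyclic_conv p f g)" unfolding density_entropy_def by (intro sum_mono)
  also have "(\<Sum>x\<in>?Z. (1/2) * (- (1 / p) * ln (1 / p)) + (1/2) * (- cyclic_conv p f r x * ln (cyclic_conv p f r x)))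
     = (1/2) * ln p + (1/2) * density_entropy p (cyclic_conv p f r)"
    unfolding sum.distrib density_entropy_def sum_distrib_left[symmetric] using assms(1) by (simp add: ln_div)
  finally show ?thesis using density_entropy_conv_ge[OF assms(1,2) r] by simp
qed


lemma cyclic_conv_right_commute:
  shows "cyclic_conv p (cyclic_conv p f g) h = cyclic_conv p (cyclic_conv p f h) g"
proof
  fix x
  show "cyclic_conv p (cyclic_conv p f g) h x = cyclic_conv p (cyclic_conv p f h) g x"
    unfolding cyclic_conv_def sum_distrib_left
    by (subst sum.swap) (simp add: algebra_simps)
qed

lemma sum_cyclic_conv_expectation:
  fixes f g u :: "int \<Rightarrow> real"
  assumes "p > 0" "periodic p f" "periodic p u"
  shows "(\<Sum>x\<in>{0..<int p}. \<Sum>y\<in>{0..<int p}. g y * f (x - y) * u (x - y))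
       = (\<Sum>y\<in>{0..<int p}. g y) * (\<Sum>x\<in>{0..<int p}. f x * u x)"
proof -
  let ?Z = "{0..<int p}"
  have "periodic p (\<lambda>x. f x * u x)" using assms by (simp add: periodic_def)
  then have shift: "(\<Sum>x\<in>?Z. f (x + a) * u (x + a)) = (\<Sum>x\<in>?Z. f x * u x)" for a
    by (rule sum_periodic_shift[OF assms(1)])
  have "(\<Sum>x\<in>?Z. \<Sum>y\<in>?Z. g y * f (x - y) * u (x - y))
      = (\<Sum>y\<in>?Z. g y * (\<Sum>x\<in>?Z. f (x + - y) * u (x + - y)))"
    by (subst sum.swap) (simp only: sum_distrib_left mult.assoc add_uminus_conv_diff)
  then show ?thesis unfolding shift by (simp only: sum_distrib_right)
qed

text \<open>
  If \<open>X\<close>, \<open>Y\<close>, \<open>Z\<close> are independent with densities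
  \<open>f\<close>, \<open>g\<close>, \<open>h\<close>, then \<open>H(X + Y) - H(X)\<close> is the
  mutual information of \<open>X + Y\<close> and \<open>Y\<close>, which the additional noise
  \<open>Z\<close> can only decrease. In the proof, \<open>w x y z\<close> is the joint weight of
  \<open>X + Y + Z = x\<close>, \<open>Y = y\<close>, \<open>Z = z\<close>, and the difference of
  the two sides is the expectation of a single logarithm, bounded by \<open>ln r \<le> r -
  1\<close>.
\<close>
lemma density_entropy_submodular:
  assumes p: "p > 0" and f: "prob_density p f" and g: "prob_density p g" and h: "prob_density p h"
  shows "density_entropy p (cyclic_conv p (cyclic_conv p f g) h) + density_entropy p f \<le> density_entropy p (cyclic_conv p f g) + density_entropy p (cyclic_conv p f h)"
proof -
  let ?Z = "{0..<int p}"
  define G where "G = cyclic_conv p f g"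
  define H where "H = cyclic_conv p f h"
  define K where "K = cyclic_conv p G h"
  have dG: "prob_density p G" and dH: "prob_density p H" and dK: "prob_density p K"
    using assms by (auto simp: G_def H_def K_def intro!: prob_density_conv)
  have K': "K x = (\<Sum>y\<in>?Z. g y * H (x - y))" for x
    unfolding K_def G_def H_def by (subst cyclic_conv_right_commute) (simp only: cyclic_conv_def)
  have K'': "K x = (\<Sum>z\<in>?Z. h z * G (x - z))" for x by (simp add: K_def cyclic_conv_def)
  note nn = prob_densityD(2)[OF f] prob_densityD(2)[OF g] prob_densityD(2)[OF h] prob_densityD(2)[OF dG]
    prob_densityD(2)[OF dH] prob_densityD(2)[OF dK]
  define w where "w x y z = g y * h z * f (x - y - z)" for x y z
  have pointwise: "w x y z * (ln (G (x - z)) + ln (H (x - y)) - ln (K x) - ln (f (x - y - z)))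
      \<le> g y * H (x - y) * (h z * G (x - z)) / K x - w x y z"
    if "y \<in> ?Z" "z \<in> ?Z" for x y z
  proof (cases "w x y z = 0")
    case True
    then show ?thesis using nn by (simp add: divide_nonneg_nonneg)
  next
    case False
    then have pos: "0 < g y" "0 < h z" "0 < f (x - y - z)"
      using nn by (auto simp: w_def less_le)
    have "g y * f (x - z - y) \<le> G (x - z)" unfolding G_def cyclic_conv_def
      by (rule member_le_sum) (use that nn in auto)
    then have "0 < G (x - z)" using pos
      by (smt (verit, ccfv_threshold) diff_right_commute mult_pos_pos)
    moreover have "h z * f (x - y - z) \<le> H (x - y)" unfolding H_def cyclic_conv_def
      by (rule member_le_sum) (use that nn in auto)
    then have "0 < H (x - y)" using pos
      by (smt (verit, ccfv_threshold) mult_pos_pos)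
    moreover have "g y * H (x - y) \<le> K x" unfolding K'
      by (rule member_le_sum) (use that nn in auto)
    then have "0 < K x" using pos calculation
      by (smt (verit, ccfv_threshold) mult_pos_pos)
    ultimately have r: "0 < G (x - z)" "0 < H (x - y)" "0 < K x" by auto
    have "f (x - y - z) * (ln (G (x - z) * H (x - y) / K x) - ln (f (x - y - z)))
        \<le> G (x - z) * H (x - y) / K x - f (x - y - z)"
      using r pos by (intro ln_le_ratio) auto
    then have "(g y * h z) * (f (x - y - z) * (ln (G (x - z)) + ln (H (x - y)) - ln (K x) - ln (f (x - y - z))))
        \<le> (g y * h z) * (G (x - z) * H (x - y) / K x - f (x - y - z))"
      using r pos by (intro mult_left_mono) (simp_all add: ln_mult ln_div)
    then show ?thesis by (simp add: w_def algebra_simps)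
  qed
  have lhs: "(\<Sum>x\<in>?Z. \<Sum>y\<in>?Z. \<Sum>z\<in>?Z. w x y z * (ln (G (x - z)) + ln (H (x - y)) - ln (K x) - ln (f (x - y - z))))
      = - density_entropy p G - density_entropy p H + density_entropy p K + density_entropy p f"
  proof -
    have per: "periodic p (\<lambda>x. ln (a x))" if "prob_density p a" for a
      using prob_densityD(1)[OF that] by (simp add: periodic_def)
    have wG: "(\<Sum>y\<in>?Z. w x y z) = h z * G (x - z)" for x z
      by (simp add: w_def G_def cyclic_conv_def sum_distrib_left algebra_simps)
    have wH: "(\<Sum>z\<in>?Z. w x y z) = g y * H (x - y)" for x y
      by (simp add: w_def H_def cyclic_conv_def sum_distrib_left algebra_simps)
    have "(\<Sum>x\<in>?Z. \<Sum>y\<in>?Z. \<Sum>z\<in>?Z. w x y z * ln (G (x - z)))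
        = (\<Sum>x\<in>?Z. \<Sum>z\<in>?Z. h z * G (x - z) * ln (G (x - z)))"
      by (rule sum.cong[OF refl], subst sum.swap) (simp only: sum_distrib_right[symmetric] wG)
    also have "\<dots> = - density_entropy p G"
      using sum_cyclic_conv_expectation[OF p prob_densityD(1)[OF dG] per[OF dG]] prob_densityD(3)[OF h]
      by (simp add: density_entropy_def sum_negf)
    finally have 1: "(\<Sum>x\<in>?Z. \<Sum>y\<in>?Z. \<Sum>z\<in>?Z. w x y z * ln (G (x - z))) = - density_entropy p G" .
    have "(\<Sum>x\<in>?Z. \<Sum>y\<in>?Z. \<Sum>z\<in>?Z. w x y z * ln (H (x - y)))
        = (\<Sum>x\<in>?Z. \<Sum>y\<in>?Z. g y * H (x - y) * ln (H (x - y)))"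
      by (simp only: sum_distrib_right[symmetric] wH)
    also have "\<dots> = - density_entropy p H"
      using sum_cyclic_conv_expectation[OF p prob_densityD(1)[OF dH] per[OF dH]] prob_densityD(3)[OF g]
      by (simp add: density_entropy_def sum_negf)
    finally have 2: "(\<Sum>x\<in>?Z. \<Sum>y\<in>?Z. \<Sum>z\<in>?Z. w x y z * ln (H (x - y))) = - density_entropy p H" .
    have 3: "(\<Sum>x\<in>?Z. \<Sum>y\<in>?Z. \<Sum>z\<in>?Z. w x y z * ln (K x)) = - density_entropy p K"
      by (simp only: sum_distrib_right[symmetric] wH K'[symmetric]) (simp add: density_entropy_def sum_negf)
    have "(\<Sum>x\<in>?Z. \<Sum>y\<in>?Z. \<Sum>z\<in>?Z. w x y z * ln (f (x - y - z)))
        = (\<Sum>x\<in>?Z. \<Sum>y\<in>?Z. g y * 1 * (\<Sum>z\<in>?Z. h z * f ((x - y) - z) * ln (f ((x - y) - z))))"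
      by (simp add: w_def sum_distrib_left mult_ac)
    also have "\<dots> = (\<Sum>y\<in>?Z. g y) * (\<Sum>x\<in>?Z. 1 * (\<Sum>z\<in>?Z. h z * f (x - z) * ln (f (x - z))))"
    proof (rule sum_cyclic_conv_expectation[OF p])
      show "periodic p (\<lambda>x. \<Sum>z\<in>?Z. h z * f (x - z) * ln (f (x - z)))"
        unfolding periodic_def using periodic_cong[OF prob_densityD(1)[OF f]]
        by (intro allI sum.cong refl) (metis mod_diff_left_eq)
    qed (simp add: periodic_def)
    also have "\<dots> = - density_entropy p f"
      using sum_cyclic_conv_expectation[OF p prob_densityD(1)[OF f] per[OF f]] prob_densityD(3)[OF g] prob_densityD(3)[OF h]
      by (simp add: density_entropy_def sum_negf)
    finally have 4: "(\<Sum>x\<in>?Z. \<Sum>y\<in>?Z. \<Sum>z\<in>?Z. w x y z * ln (f (x - y - z))) = - density_entropy p f" .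
    show ?thesis
      unfolding right_diff_distrib distrib_left sum_subtractf sum.distrib 1 2 3 4 by simp
  qed
  have "(\<Sum>x\<in>?Z. \<Sum>y\<in>?Z. \<Sum>z\<in>?Z. w x y z * (ln (G (x - z)) + ln (H (x - y)) - ln (K x) - ln (f (x - y - z))))
     \<le> (\<Sum>x\<in>?Z. \<Sum>y\<in>?Z. \<Sum>z\<in>?Z. g y * H (x - y) * (h z * G (x - z)) / K x - w x y z)"
    by (intro sum_mono pointwise)
  also have "\<dots> = (\<Sum>x\<in>?Z. K x * K x / K x - K x)"
  proof (rule sum.cong[OF refl])
    fix x
    have "(\<Sum>y\<in>?Z. \<Sum>z\<in>?Z. g y * H (x - y) * (h z * G (x - z)) / K x) = K x * K x / K x"
      by (simp only: sum_divide_distrib[symmetric] sum_distrib_left[symmetric] sum_distrib_right[symmetric]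
          K'[symmetric] K''[symmetric])
    moreover have "(\<Sum>y\<in>?Z. \<Sum>z\<in>?Z. w x y z) = K x"
      unfolding K' H_def cyclic_conv_def by (simp add: w_def sum_distrib_left mult_ac)
    ultimately show "(\<Sum>y\<in>?Z. \<Sum>z\<in>?Z. g y * H (x - y) * (h z * G (x - z)) / K x - w x y z) = K x * K x / K x - K x"
      by (simp add: sum_subtractf)
  qed
  also have "\<dots> = 0" by simp
  finally show ?thesis unfolding lhs by (simp add: G_def H_def K_def)
qed

text \<open>
  Subtract the chord. If the difference \<open>g\<close> were positive somewhere, then at the
  smallest point \<open>a\<close> where it attains its maximum the midpoint inequality would fail
  for \<open>a - h\<close> and \<open>a + h\<close>.
\<close>
lemma continuous_midpoint_convex:
  fixes f :: "real \<Rightarrow> real"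
  assumes S: "convex S" and cont: "continuous_on S f"
    and mid: "\<And>x y. x \<in> S \<Longrightarrow> y \<in> S \<Longrightarrow> f ((x + y) / 2) \<le> (f x + f y) / 2"
  shows "convex_on S f"
proof (rule convex_on_linorderI[OF _ S])
  fix t x y :: real
  assume t: "0 < t" "t < 1" and xy: "x \<in> S" "y \<in> S" "x < y"
  have sub: "{x..y} \<subseteq> S"
    using S xy by (metis closed_segment_eq_real_ivl closed_segment_subset less_imp_le)
  define c where "c = (f y - f x) / (y - x)"
  define g where "g u = f u - (f x + c * (u - x))" for u
  have g0: "g x = 0" "g y = 0" using xy by (auto simp: g_def c_def)
  have gmid: "g ((u + v) / 2) \<le> (g u + g v) / 2" if "u \<in> {x..y}" "v \<in> {x..y}" for u v
    using mid[of u v] that sub by (force simp: g_def field_simps)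
  have gcont: "continuous_on {x..y} g"
    unfolding g_def by (intro continuous_intros continuous_on_subset[OF cont sub])
  have "g u \<le> 0" if u: "u \<in> {x..y}" for u
  proof (rule ccontr)
    assume neg: "\<not> g u \<le> 0"
    obtain m where m: "m \<in> {x..y}" "\<And>v. v \<in> {x..y} \<Longrightarrow> g v \<le> g m"
      using continuous_attains_sup[OF compact_Icc _ gcont] u by blast
    define A where "A = {v \<in> {x..y}. g v = g m}"
    have "A = {x..y} \<inter> g -` {g m}" by (auto simp: A_def)
    then have "closed A" using continuous_closed_preimage[OF gcont, of "{g m}"] by simp
    moreover have "A \<subseteq> {x..y}" by (auto simp: A_def)
    ultimately have "compact A" using bounded_subset[OF compact_imp_bounded[OF compact_Icc]]
      by (simp add: compact_eq_bounded_closed)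
    then obtain a where a: "a \<in> A" "\<And>v. v \<in> A \<Longrightarrow> a \<le> v"
      using compact_attains_inf[of A] m by (auto simp: A_def)
    have pos: "0 < g a" using a(1) m(2)[OF u] neg by (auto simp: A_def)
    then have "a \<noteq> x" "a \<noteq> y" using g0 by auto
    then have a': "x < a" "a < y" using a(1) by (auto simp: A_def)
    define h where "h = min (a - x) (y - a)"
    have h: "0 < h" "a - h \<in> {x..y}" "a + h \<in> {x..y}" using a' by (auto simp: h_def)
    have "a - h \<notin> A" using a(2)[of "a - h"] h by auto
    then have "g (a - h) < g a" using h m(2)[of "a - h"] a(1) by (auto simp: A_def less_le)
    moreover have "g (a + h) \<le> g a" using h m(2)[of "a + h"] a(1) by (auto simp: A_def)
    ultimately show False using gmid[OF h(2,3)] by simp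
  qed
  moreover have "(1 - t) * x + t * y \<in> {x..y}"
    using t xy convex_bound_le[of x y y "1 - t" t] by (auto simp: algebra_simps mult_left_mono)
  ultimately have "f ((1 - t) * x + t * y) \<le> f x + c * ((1 - t) * x + t * y - x)"
    by (fastforce simp: g_def)
  also have "c * ((1 - t) * x + t * y - x) = t * (c * (y - x))" by (simp add: algebra_simps)
  also have "c * (y - x) = f y - f x" using xy by (simp add: c_def)
  finally show "f ((1 - t) *\<^sub>R x + t *\<^sub>R y) \<le> (1 - t) * f x + t * f y"
    by (simp add: algebra_simps)
qed


section \<open>The law of one coordinate\<close>

lemma fourier_series_conv:
  assumes "p > 0"
  shows "(\<Sum>y\<in>{0..<int p}. fourier_series p b y * fourier_series p a (x - y)) = fourier_series p (\<lambda>j. a j * b j) x"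
proof -
  let ?Z = "{0..<int p}" and ?c = "1 / (of_nat p)\<^sup>2 :: complex"
  have orth: "(\<Sum>y\<in>?Z. root_char p (y * (j - l))) = (if j = l then of_nat p else 0)"
    if "j \<in> ?Z" "l \<in> ?Z" for j l
  proof -
    have "int p dvd j - l \<longleftrightarrow> j = l"
      using that by (metis atLeastLessThan_iff mod_eq_dvd_iff mod_pos_pos_trivial)
    then show ?thesis using sum_root_char[OF assms, of "j - l"] by simp
  qed
  have "(\<Sum>y\<in>?Z. fourier_series p b y * fourier_series p a (x - y))
      = (\<Sum>y\<in>?Z. \<Sum>j\<in>?Z. \<Sum>l\<in>?Z. ?c * (a j * b l * root_char p (- j * x)) * root_char p (y * (j - l)))"
  proof (intro sum.cong refl)
    fix y
    have "fourier_series p b y * fourier_series p a (x - y)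
        = ?c * ((\<Sum>j\<in>?Z. a j * root_char p (- j * (x - y))) * (\<Sum>l\<in>?Z. b l * root_char p (- l * y)))"
      by (simp add: fourier_series_def power2_eq_square)
    also have "\<dots> = (\<Sum>j\<in>?Z. \<Sum>l\<in>?Z. ?c * ((a j * root_char p (- j * (x - y))) * (b l * root_char p (- l * y))))"
      by (subst sum_product) (simp only: sum_distrib_left)
    also have "\<dots> = (\<Sum>j\<in>?Z. \<Sum>l\<in>?Z. ?c * (a j * b l * root_char p (- j * x)) * root_char p (y * (j - l)))"
    proof (intro sum.cong refl)
      fix j l
      have "root_char p (- j * (x - y)) * root_char p (- l * y) = root_char p (- j * x) * root_char p (y * (j - l))"
        by (simp add: root_char_add[symmetric] algebra_simps)
      then show "?c * ((a j * root_char p (- j * (x - y))) * (b l * root_char p (- l * y)))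
          = ?c * (a j * b l * root_char p (- j * x)) * root_char p (y * (j - l))"
        by (metis (no_types, lifting) mult.assoc mult.left_commute)
    qed
    finally show "fourier_series p b y * fourier_series p a (x - y)
        = (\<Sum>j\<in>?Z. \<Sum>l\<in>?Z. ?c * (a j * b l * root_char p (- j * x)) * root_char p (y * (j - l)))" .
  qed
  also have "\<dots> = (\<Sum>j\<in>?Z. \<Sum>y\<in>?Z. \<Sum>l\<in>?Z. ?c * (a j * b l * root_char p (- j * x)) * root_char p (y * (j - l)))"
    by (rule sum.swap)
  also have "\<dots> = (\<Sum>j\<in>?Z. \<Sum>l\<in>?Z. \<Sum>y\<in>?Z. ?c * (a j * b l * root_char p (- j * x)) * root_char p (y * (j - l)))"
    by (intro sum.cong refl sum.swap)
  also have "\<dots> = (\<Sum>j\<in>?Z. \<Sum>l\<in>?Z. ?c * (a j * b l * root_char p (- j * x)) * (\<Sum>y\<in>?Z. root_char p (y * (j - l))))"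
    by (simp only: sum_distrib_left)
  also have "\<dots> = (\<Sum>j\<in>?Z. \<Sum>l\<in>?Z. if l = j then ?c * (a j * b j * root_char p (- j * x)) * of_nat p else 0)"
    by (intro sum.cong refl) (auto simp: orth)
  also have "\<dots> = (\<Sum>j\<in>?Z. ?c * (a j * b j * root_char p (- j * x)) * of_nat p)"
    by (intro sum.cong refl) (simp add: sum.delta)
  also have "\<dots> = fourier_series p (\<lambda>j. a j * b j) x"
    using assms by (simp add: fourier_series_def sum_distrib_left power2_eq_square)
  finally show ?thesis .
qed

lemma fourier_series_coeff:
  assumes "p > 0" "m \<in> {0..<int p}"
  shows "(\<Sum>x\<in>{0..<int p}. fourier_series p a x * root_char p (m * x)) = a m"
proof -
  let ?Z = "{0..<int p}"
  have orth: "(\<Sum>x\<in>?Z. root_char p (x * (m - j))) = (if j = m then of_nat p else 0)" if "j \<in> ?Z" for j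
  proof -
    have "int p dvd m - j \<longleftrightarrow> j = m"
      using that assms(2) by (metis atLeastLessThan_iff mod_eq_dvd_iff mod_pos_pos_trivial)
    then show ?thesis using sum_root_char[OF assms(1), of "m - j"] by simp
  qed
  have "(\<Sum>x\<in>?Z. fourier_series p a x * root_char p (m * x))
      = (\<Sum>x\<in>?Z. \<Sum>j\<in>?Z. (1 / of_nat p) * a j * root_char p (x * (m - j)))"
    unfolding fourier_series_def sum_distrib_left sum_distrib_right
  proof (intro sum.cong refl)
    fix x j
    have "root_char p (x * (m - j)) = root_char p (- j * x) * root_char p (m * x)"
      by (simp add: root_char_add[symmetric] algebra_simps)
    then show "1 / of_nat p * (a j * root_char p (- j * x)) * root_char p (m * x)
       = 1 / of_nat p * a j * root_char p (x * (m - j))" by (simp only: mult.assoc)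
  qed
  also have "\<dots> = (\<Sum>j\<in>?Z. (1 / of_nat p) * a j * (\<Sum>x\<in>?Z. root_char p (x * (m - j))))"
    by (subst sum.swap) (simp only: sum_distrib_left)
  also have "\<dots> = (\<Sum>j\<in>?Z. if j = m then a m else 0)"
    using assms(1) by (intro sum.cong refl) (simp add: orth)
  finally show ?thesis using assms(2) by (simp add: sum.delta)
qed

lemma multiplier_add: "multiplier w p (s + r) j = multiplier w p s j * multiplier w p r j"
  by (simp add: multiplier_def exp_add[symmetric] distrib_right)

lemma norm_multiplier: "norm (multiplier w p s j) = exp (- s * (1 - cos (2 * pi * of_int j / p)))"
  by (simp add: multiplier_def Re_increment_char algebra_simps)

definition coord_density :: "walk \<Rightarrow> nat \<Rightarrow> real \<Rightarrow> int \<Rightarrow> real" where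
  "coord_density w p s x = pmf (coord_pmf w p s) (x mod int p)"

lemma coord_density_fourier:
  assumes "p > 0" "s \<ge> 0"
  shows "complex_of_real (coord_density w p s x) = fourier_series p (multiplier w p s) x"
proof -
  have "complex_of_real (coord_density w p s x) = fourier_series p (multiplier w p s) (x mod int p)"
    using assms unfolding coord_density_def by (intro pmf_coord_pmf) auto
  then show ?thesis
    by (simp only: fourier_series_def root_char_mod)
qed

lemma prob_density_coord_density:
  assumes "p > 0"
  shows "prob_density p (coord_density w p s)"
proof -
  have "(\<Sum>x\<in>{0..<int p}. coord_density w p s x) = (\<Sum>x\<in>{0..<int p}. pmf (coord_pmf w p s) x)"
    by (simp add: coord_density_def)
  also have "\<dots> = 1" by (rule sum_pmf_eq_1[OF _ set_pmf_coord_pmf[OF assms]]) simp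
  finally show ?thesis by (simp add: prob_density_def periodic_def coord_density_def)
qed

lemma coord_density_add:
  assumes "p > 0" "s \<ge> 0" "r \<ge> 0"
  shows "coord_density w p (s + r) = cyclic_conv p (coord_density w p s) (coord_density w p r)"
proof
  fix x
  have "complex_of_real (coord_density w p (s + r) x)
      = complex_of_real (cyclic_conv p (coord_density w p s) (coord_density w p r) x)"
    using assms
    by (simp add: cyclic_conv_def coord_density_fourier multiplier_add[abs_def] fourier_series_conv)
  then show "coord_density w p (s + r) x = cyclic_conv p (coord_density w p s) (coord_density w p r) x"
    by (simp only: of_real_eq_iff)
qed

lemma continuous_coord_density:
  assumes "p > 0"
  shows "continuous_on {0..} (\<lambda>s. coord_density w p s x)"
proof -
  have "continuous_on {0..} (\<lambda>s. Re (fourier_series p (multiplier w p s) x))"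
    unfolding fourier_series_def multiplier_def by (intro continuous_intros)
  then show ?thesis
    by (rule continuous_on_eq) (metis assms atLeast_iff coord_density_fourier Re_complex_of_real)
qed

text \<open>
  The simple walk at time \<open>2 s\<close> makes independent numbers, both Poisson with mean
  \<open>s\<close>, of steps \<open>+1\<close> and \<open>-1\<close>. So it is the difference of
  two independent directed walks at time \<open>s\<close>.
\<close>
lemma simple_eq_conv_directed:
  assumes "p > 0" "s \<ge> 0"
  shows "coord_density Simple p (2 * s) = cyclic_conv p (coord_density Directed p s) (\<lambda>x. coord_density Directed p s (- x))"
proof
  fix x
  have refl: "complex_of_real (coord_density Directed p s (- y)) = fourier_series p (\<lambda>j. cnj (multiplier Directed p s j)) y" for y
  proof -
    have "complex_of_real (coord_density Directed p s (- y)) = cnj (complex_of_real (coord_density Directed p s (- y)))"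
      by simp
    also have "\<dots> = cnj (fourier_series p (multiplier Directed p s) (- y))"
      using assms by (simp only: coord_density_fourier)
    finally show ?thesis by (simp add: fourier_series_def cnj_root_char)
  qed
  have "multiplier Simple p (2 * s) = (\<lambda>j. multiplier Directed p s j * cnj (multiplier Directed p s j))"
  proof
    fix j
    have "of_real (2 * s) * (increment_char Simple p j - 1)
       = of_real s * (increment_char Directed p j - 1) + cnj (of_real s * (increment_char Directed p j - 1))"
      by (simp add: increment_char_simps root_char_def complex_eq_iff)
    then show "multiplier Simple p (2 * s) j = multiplier Directed p s j * cnj (multiplier Directed p s j)"
      by (simp only: multiplier_def exp_add[symmetric] exp_cnj)
  qed
  then have "complex_of_real (coord_density Simple p (2 * s) x)
      = complex_of_real (cyclic_conv p (coord_density Directed p s) (\<lambda>x. coord_density Directed p s (- x)) x)"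
    using assms by (simp add: cyclic_conv_def coord_density_fourier refl fourier_series_conv)
  then show "coord_density Simple p (2 * s) x = cyclic_conv p (coord_density Directed p s) (\<lambda>x. coord_density Directed p s (- x)) x"
    by (simp only: of_real_eq_iff)
qed

definition coord_entropy :: "walk \<Rightarrow> nat \<Rightarrow> real \<Rightarrow> real" where
  "coord_entropy w p s = density_entropy p (coord_density w p s)"

lemma walk_entropy_eq_coord_entropy:
  assumes "p > 0" "k > 0" "t \<ge> 0"
  shows "walk_entropy w p k t = k * coord_entropy w p (t / k)"
proof -
  let ?c = "coord_pmf w p (t / k)"
  have sub: "set_pmf ?c \<subseteq> {0..<int p}" using assms by (intro set_pmf_coord_pmf)
  have "shannon_entropy ?c = - (\<Sum>x\<in>set_pmf ?c. pmf ?c x * ln (pmf ?c x))"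
    using sub by (intro shannon_entropy_eq_sum) (auto intro: finite_subset)
  also have "(\<Sum>x\<in>set_pmf ?c. pmf ?c x * ln (pmf ?c x)) = (\<Sum>x\<in>{0..<int p}. pmf ?c x * ln (pmf ?c x))"
    using sub by (intro sum.mono_neutral_left) (auto simp: set_pmf_iff)
  finally have "shannon_entropy ?c = coord_entropy w p (t / k)"
    by (simp add: coord_entropy_def density_entropy_def coord_density_def sum_negf)
  then show ?thesis using walk_entropy_eq[OF assms] by simp
qed

lemma coord_entropy_0:
  assumes "p > 0" shows "coord_entropy w p 0 = 0"
proof -
  have "coord_pmf w p 0 = return_pmf 0" by (simp add: coord_pmf_def walk_law_def)
  then show ?thesis
    by (simp add: coord_entropy_def density_entropy_def coord_density_def indicator_def) (auto intro!: sum.neutral)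
qed

text \<open>
  Only the point \<open>0\<close> needs an argument: \<open>- x ln x \<le> 2 sqrt x\<close> for
  \<open>0 < x < 1\<close>.
\<close>
lemma continuous_on_entropy_fun: "continuous_on {0..} (\<lambda>x::real. - x * ln x)"
proof -
  have bound: "0 \<le> - x * ln x \<and> - x * ln x \<le> 2 * sqrt x" if "0 < x" "x < 1" for x :: real
  proof -
    have "ln (1 / sqrt x) \<le> 1 / sqrt x - 1" using that by (intro ln_le_minus_one) simp
    then have "- ln x \<le> 2 / sqrt x" using that by (simp add: ln_div ln_sqrt)
    then have "x * - ln x \<le> x * (2 / sqrt x)" using that by (intro mult_left_mono) auto
    also have "\<dots> = 2 * sqrt x" using that by (simp add: field_simps)
    finally show ?thesis using that by (simp add: mult_nonneg_nonpos)
  qed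
  have lim: "((\<lambda>x::real. - x * ln x) \<longlongrightarrow> 0) (at_right 0)"
  proof (rule tendsto_sandwich[of "\<lambda>_. 0" _ _ "\<lambda>x. 2 * sqrt x"])
    show "((\<lambda>x. 2 * sqrt x) \<longlongrightarrow> 0) (at_right (0::real))"
      by (rule tendsto_eq_intros refl tendsto_ident_at | simp)+
    show "eventually (\<lambda>x. 0 \<le> - x * ln x) (at_right (0::real))"
      "eventually (\<lambda>x. - x * ln x \<le> 2 * sqrt x) (at_right (0::real))"
      using bound unfolding eventually_at_right_field by (meson zero_less_one)+
  qed simp
  show ?thesis unfolding continuous_on_def
  proof
    fix x :: real assume x: "x \<in> {0..}"
    show "((\<lambda>x. - x * ln x) \<longlongrightarrow> - x * ln x) (at x within {0..})"
    proof (cases "x = 0")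
      case True
      have "at (0::real) within {0..} = at_right 0"
        by (rule at_within_Ici_at_right)
      then show ?thesis using lim True by simp
    next
      case False
      then have "isCont (\<lambda>x. - x * ln x) x" by (intro continuous_intros) auto
      then show ?thesis unfolding isCont_def by (rule tendsto_within_subset) simp
    qed
  qed
qed

lemma continuous_coord_entropy:
  assumes "p > 0"
  shows "continuous_on {0..} (coord_entropy w p)"
proof -
  have "continuous_on {0..} (\<lambda>s. \<Sum>x\<in>{0..<int p}. - coord_density w p s x * ln (coord_density w p s x))"
    using prob_density_coord_density[OF assms]
    by (intro continuous_on_sum continuous_on_compose2[OF continuous_on_entropy_fun continuous_coord_density[OF assms]])
       (auto simp: prob_density_def)
  then show ?thesis by (simp add: coord_entropy_def[abs_def] density_entropy_def)
qed

definition entropy_gap :: "walk \<Rightarrow> nat \<Rightarrow> real \<Rightarrow> real" where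
  "entropy_gap w p s = ln p - coord_entropy w p s"

lemma continuous_entropy_gap:
  "p > 0 \<Longrightarrow> continuous_on {0..} (entropy_gap w p)"
  unfolding entropy_gap_def by (intro continuous_intros continuous_coord_entropy)

text \<open>
  Apply submodularity with \<open>X\<close> the walk at the earlier time and \<open>Y\<close>,
  \<open>Z\<close> two independent further increments of the same length.
\<close>
lemma convex_entropy_gap:
  assumes "p > 0"
  shows "convex_on {0..} (entropy_gap w p)"
proof (rule continuous_midpoint_convex[OF convex_real_interval(1) continuous_entropy_gap[OF assms]])
  let ?q = "coord_density w p"
  have mid: "entropy_gap w p ((x + y) / 2) \<le> (entropy_gap w p x + entropy_gap w p y) / 2"
    if "0 \<le> x" "x \<le> y" for x y
  proof -
    define r where "r = (y - x) / 2"
    have r: "0 \<le> r" "(x + y) / 2 = x + r" "y = x + r + r" using that by (auto simp: r_def field_simps)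
    have one: "?q (x + r) = cyclic_conv p (?q x) (?q r)"
      using that r assms by (intro coord_density_add) auto
    have two: "?q (x + r + r) = cyclic_conv p (cyclic_conv p (?q x) (?q r)) (?q r)"
      unfolding one[symmetric] using that r assms by (intro coord_density_add) auto
    have "coord_entropy w p (x + r + r) + coord_entropy w p x \<le> 2 * coord_entropy w p (x + r)"
      using density_entropy_submodular[OF assms prob_density_coord_density prob_density_coord_density prob_density_coord_density, OF assms assms assms, of w x w r w r]
      unfolding coord_entropy_def one two by simp
    then show ?thesis unfolding r(2) unfolding r(3) by (simp add: entropy_gap_def)
  qed
  fix x y :: real assume "x \<in> {0..}" "y \<in> {0..}"
  then show "entropy_gap w p ((x + y) / 2) \<le> (entropy_gap w p x + entropy_gap w p y) / 2"
    using mid[of x y] mid[of y x] by (cases "x \<le> y") (simp_all add: add.commute)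
qed


section \<open>Quantitative entropy bounds\<close>

text \<open>
  For a representative \<open>0 \<le> x < p\<close> this is the distance from \<open>x\<close> to
  \<open>0\<close> on the cycle.
\<close>
definition circ_dist :: "nat \<Rightarrow> int \<Rightarrow> real" where
  "circ_dist p x = of_int (min x (int p - x))"

lemma circ_dist_nonneg: "x \<in> {0..<int p} \<Longrightarrow> 0 \<le> circ_dist p x"
  by (simp add: circ_dist_def)

text \<open>
  The distance is a nonnegative integer.
\<close>
lemma circ_dist_le_square:
  assumes "x \<in> {0..<int p}"
  shows "circ_dist p x \<le> (circ_dist p x)\<^sup>2"
proof -
  define m where "m = min x (int p - x)"
  have "m = 0 \<or> 1 \<le> m" using assms by (auto simp: m_def)
  then have "m \<le> m\<^sup>2" by (auto simp: power2_eq_square)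
  then have "real_of_int m \<le> real_of_int (m\<^sup>2)" by (simp only: of_int_le_iff)
  then show ?thesis by (simp add: circ_dist_def m_def)
qed

text \<open>
  Concavity of the sine on \<open>[0, \<pi>]\<close>.
\<close>
lemma sin_ge_chord:
  assumes "0 \<le> x" "x \<le> pi / 2"
  shows "2 / pi * x \<le> sin x"
proof -
  have "concave_on {0..pi} sin"
  proof (rule f''_le0_imp_concave)
    show "DERIV sin x :> cos x" "DERIV cos x :> - sin x" for x :: real
      by (auto intro!: derivative_eq_intros)
    show "- sin x \<le> 0" if "x \<in> {0..pi}" for x :: real
      using that by (simp add: sin_ge_zero)
  qed simp
  from concave_onD[OF this, of "2 * x / pi" 0 "pi / 2"] show ?thesis
    using assms by (simp add: field_simps)
qed

text \<open>
  Used in two ways: at a frequency it bounds the modulus of a multiplier by a Gaussian, and at a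
  position it bounds the squared distance by a trigonometric function whose expectation is a
  Fourier coefficient.
\<close>
lemma one_minus_cos_ge:
  assumes "x \<in> {0..<int p}"
  shows "8 * (circ_dist p x)\<^sup>2 / (real p)\<^sup>2 \<le> 1 - cos (2 * pi * of_int x / p)"
proof -
  define \<theta> where "\<theta> = pi * circ_dist p x / p"
  have p: "0 < real p" using assms by auto
  have "cos (2 * pi * of_int x / p) = cos (2 * \<theta>)"
  proof (cases "x \<le> int p - x")
    case True
    then show ?thesis by (simp add: \<theta>_def circ_dist_def min_def mult.assoc)
  next
    case False
    then have "2 * \<theta> = 2 * pi - 2 * pi * of_int x / p"
      using p by (simp add: \<theta>_def circ_dist_def min_def field_simps)
    then show ?thesis by (simp add: cos_diff)
  qed
  then have cos: "1 - cos (2 * pi * of_int x / p) = 2 * (sin \<theta>)\<^sup>2"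
    by (simp add: cos_double_sin)
  have "2 * min x (int p - x) \<le> int p" by (cases "x \<le> int p - x") auto
  then have "real_of_int (2 * min x (int p - x)) \<le> real_of_int (int p)" by (simp only: of_int_le_iff)
  then have d: "0 \<le> circ_dist p x" "2 * circ_dist p x \<le> p"
    using circ_dist_nonneg[OF assms] by (simp_all add: circ_dist_def)
  have "0 \<le> \<theta>" using d p by (simp add: \<theta>_def)
  have "pi * (2 * circ_dist p x) \<le> pi * p" using d by (intro mult_left_mono) auto
  then have "\<theta> \<le> pi / 2" using p by (simp add: \<theta>_def field_simps)
  then have "2 / pi * \<theta> \<le> sin \<theta>" using \<open>0 \<le> \<theta>\<close> by (intro sin_ge_chord)
  then have "2 * circ_dist p x / p \<le> sin \<theta>" by (simp add: \<theta>_def)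
  then have "(2 * circ_dist p x / p)\<^sup>2 \<le> (sin \<theta>)\<^sup>2" using d p by (intro power_mono) auto
  then show ?thesis unfolding cos by (simp add: power_divide power_mult_distrib)
qed

lemma one_minus_cos_le: "1 - cos (x :: real) \<le> x\<^sup>2 / 2"
proof -
  have "\<bar>sin (x / 2)\<bar>\<^sup>2 \<le> \<bar>x / 2\<bar>\<^sup>2" by (intro power_mono abs_sin_x_le_abs_x) auto
  then show ?thesis using cos_double_sin[of "x / 2"] by (simp add: power_divide)
qed

text \<open>
  Each point of the cycle is reached from \<open>0\<close> in one of the two directions, which
  gives two geometric series. This is the only sum over the cycle that has to be estimated, for
  the Fourier sums as well as for the partition function in the upper bound on the entropy.
\<close>
lemma sum_exp_circ_dist_le:
  assumes "a > 0"
  shows "(\<Sum>x\<in>{0..<int p}. exp (- a * circ_dist p x)) \<le> 1 + 2 / a"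
proof -
  define r where "r = exp (- a)"
  have r: "0 < r" "r < 1" using assms by (auto simp: r_def)
  have pow: "exp (- a * real n) = r ^ n" for n by (simp add: r_def exp_of_nat_mult[symmetric])
  have geo: "(\<Sum>n<m. r ^ n) \<le> 1 / (1 - r)" for m
  proof -
    have "(\<Sum>n<m. r ^ n) = (1 - r ^ m) / (1 - r)" using r by (simp add: sum_gp_strict)
    also have "\<dots> \<le> 1 / (1 - r)" using r by (intro divide_right_mono) auto
    finally show ?thesis .
  qed
  have "(\<Sum>x\<in>{0..<int p}. exp (- a * circ_dist p x)) = (\<Sum>n<p. exp (- a * circ_dist p (int n)))"
    by (rule sum.reindex_bij_witness[of _ int nat]) auto
  also have "\<dots> \<le> (\<Sum>n<p. r ^ n + r * r ^ (p - Suc n))"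
  proof (rule sum_mono)
    fix n assume n: "n \<in> {..<p}"
    have "circ_dist p (int n) = real n \<or> circ_dist p (int n) = real (p - n)"
      using n by (auto simp: circ_dist_def min_def of_nat_diff)
    then have "exp (- a * circ_dist p (int n)) = r ^ n \<or> exp (- a * circ_dist p (int n)) = r ^ (p - n)"
      by (metis pow)
    moreover have "0 \<le> r ^ n" "0 \<le> r ^ (p - n)" using r by auto
    ultimately have "exp (- a * circ_dist p (int n)) \<le> r ^ n + r ^ (p - n)" by linarith
    also have "r ^ (p - n) = r * r ^ (p - Suc n)"
      using n by (simp add: Suc_diff_Suc power_Suc[symmetric] del: power_Suc)
    finally show "exp (- a * circ_dist p (int n)) \<le> r ^ n + r * r ^ (p - Suc n)" .
  qed
  also have "\<dots> = (1 + r) * (\<Sum>n<p. r ^ n)"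
    by (simp add: sum.distrib sum_distrib_left[symmetric] sum.nat_diff_reindex[of "\<lambda>n. r ^ n"] distrib_right)
  also have "\<dots> \<le> (1 + r) * (1 / (1 - r))" using r by (intro mult_left_mono geo) auto
  also have "\<dots> \<le> 1 + 2 / a"
  proof -
    have "1 + a \<le> exp a" by simp
    then have "(1 + a) * r \<le> exp a * r" using r by (intro mult_right_mono) auto
    also have "exp a * r = 1" by (simp add: r_def exp_minus)
    finally show ?thesis using r assms by (simp add: field_simps)
  qed
  finally show ?thesis .
qed

text \<open>
  At time \<open>p\<^sup>2\<close> the nonzero frequencies contribute at most \<open>\<Sum> exp (-
  8 d\<^sup>2) \<le> \<Sum> exp (- 8 d) \<le> 1 / 4\<close> to the Fourier sum, \<open>d\<close>
  being the distance from \<open>0\<close>, while frequency \<open>0\<close> contributes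
  \<open>1\<close>.
\<close>
lemma coord_density_ge_half_uniform:
  assumes "p > 0"
  shows "1 / real (2 * p) \<le> coord_density w p ((real p)\<^sup>2) x"
proof -
  let ?s = "(real p)\<^sup>2"
  define T where "T = (\<Sum>j\<in>{0..<int p} - {0}. multiplier w p ?s j * root_char p (- j * x))"
  have "complex_of_real (coord_density w p ?s x)
      = (1 / of_nat p) * (\<Sum>j\<in>{0..<int p}. multiplier w p ?s j * root_char p (- j * x))"
    using assms by (simp add: coord_density_fourier fourier_series_def)
  also have "(\<Sum>j\<in>{0..<int p}. multiplier w p ?s j * root_char p (- j * x)) = 1 + T"
    using assms by (subst sum.remove[of _ 0]) (auto simp: T_def multiplier_def increment_char_def)
  finally have eq: "coord_density w p ?s x = Re ((1 / of_nat p) * (1 + T))"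
    by (metis Re_complex_of_real)
  have "norm T \<le> (\<Sum>j\<in>{0..<int p} - {0}. exp (- 8 * circ_dist p j))"
    unfolding T_def
  proof (rule sum_norm_le)
    fix j assume j: "j \<in> {0..<int p} - {0}"
    have "8 * circ_dist p j \<le> 8 * (circ_dist p j)\<^sup>2" using circ_dist_le_square[of j p] j by simp
    also have "\<dots> = ?s * (8 * (circ_dist p j)\<^sup>2 / (real p)\<^sup>2)" using assms by simp
    also have "\<dots> \<le> ?s * (1 - cos (2 * pi * of_int j / p))"
      using j by (intro mult_left_mono one_minus_cos_ge) auto
    finally show "norm (multiplier w p ?s j * root_char p (- j * x)) \<le> exp (- 8 * circ_dist p j)"
      by (simp add: norm_mult norm_multiplier)
  qed
  also have "\<dots> = (\<Sum>j\<in>{0..<int p}. exp (- 8 * circ_dist p j)) - 1"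
    using assms by (subst (2) sum.remove[of _ 0]) (auto simp: circ_dist_def)
  also have "\<dots> \<le> 1 / 2" using sum_exp_circ_dist_le[of 8 p] by simp
  finally have "- (1 / 2) \<le> Re T" using abs_Re_le_cmod[of T] by linarith
  then show ?thesis unfolding eq using assms by (simp add: Re_divide_of_nat field_simps)
qed

lemma entropy_gap_halves:
  assumes "p > 0" "s \<ge> 0"
  shows "entropy_gap w p (s + (real p)\<^sup>2) \<le> entropy_gap w p s / 2"
  using density_entropy_conv_halfway[OF assms(1) prob_density_coord_density prob_density_coord_density coord_density_ge_half_uniform, OF assms(1,1,1), of w s w]
    coord_density_add[OF assms(1,2), of "(real p)\<^sup>2"]
  by (simp add: entropy_gap_def coord_entropy_def)

text \<open>
  The Gaussian sum \<open>\<Sum> exp (- (b d)\<^sup>2)\<close> over the frequencies is compared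
  with a geometric one by \<open>(b d)\<^sup>2 \<ge> b d - 1 / 4\<close>.
\<close>
lemma coord_density_le:
  assumes "p > 0" "0 < s" "s \<le> (real p)\<^sup>2"
  shows "coord_density w p s x \<le> 3 / sqrt s"
proof -
  define b where "b = sqrt (8 * s) / p"
  have b: "0 < b" using assms by (simp add: b_def)
  have "norm (\<Sum>j\<in>{0..<int p}. multiplier w p s j * root_char p (- j * x))
      \<le> (\<Sum>j\<in>{0..<int p}. (4/3) * exp (- b * circ_dist p j))"
  proof (rule sum_norm_le)
    fix j assume j: "j \<in> {0..<int p}"
    have "0 \<le> (b * circ_dist p j - 1 / 2)\<^sup>2" by simp
    then have "b * circ_dist p j - 1 / 4 \<le> (b * circ_dist p j)\<^sup>2"
      by (simp add: power2_eq_square algebra_simps)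
    also have "\<dots> = s * (8 * (circ_dist p j)\<^sup>2 / (real p)\<^sup>2)"
      using assms by (simp add: b_def power_mult_distrib power_divide)
    also have "\<dots> \<le> s * (1 - cos (2 * pi * of_int j / p))"
      using j assms by (intro mult_left_mono one_minus_cos_ge) auto
    finally have "norm (multiplier w p s j * root_char p (- j * x)) \<le> exp (1 / 4 - b * circ_dist p j)"
      by (simp add: norm_mult norm_multiplier)
    also have "\<dots> = exp (1 / 4) * exp (- b * circ_dist p j)" by (simp add: exp_add[symmetric])
    also have "exp (1 / 4 :: real) \<le> 4 / 3"
    proof -
      have "3 / 4 \<le> exp (- (1 / 4) :: real)" using exp_ge_add_one_self[of "- (1/4) :: real"] by simp
      then have "3 / 4 * exp (1 / 4) \<le> exp (- (1 / 4)) * exp (1 / 4 :: real)" by (intro mult_right_mono) auto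
      then show ?thesis by (simp add: exp_add[symmetric])
    qed
    finally show "norm (multiplier w p s j * root_char p (- j * x)) \<le> 4 / 3 * exp (- b * circ_dist p j)"
      by simp
  qed
  also have "\<dots> \<le> 4 / 3 * (1 + 2 / b)"
    unfolding sum_distrib_left[symmetric] using sum_exp_circ_dist_le[OF b, of p] by simp
  finally have norm_le: "norm (\<Sum>j\<in>{0..<int p}. multiplier w p s j * root_char p (- j * x)) \<le> 4 / 3 * (1 + 2 / b)" .
  have "coord_density w p s x = norm (complex_of_real (coord_density w p s x))"
    using prob_densityD(2)[OF prob_density_coord_density[OF assms(1)]] by simp
  also have "\<dots> = norm (\<Sum>j\<in>{0..<int p}. multiplier w p s j * root_char p (- j * x)) / p"
    using assms by (simp add: coord_density_fourier fourier_series_def norm_divide)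
  also have "\<dots> \<le> 4 / 3 * (1 + 2 / b) / p" using norm_le by (intro divide_right_mono) auto
  also have "\<dots> = 4 / 3 * (1 / p + 2 / sqrt (8 * s))" using assms by (simp add: b_def field_simps)
  also have "\<dots> \<le> 4 / 3 * (1 / sqrt s + 2 / sqrt (4 * s))"
  proof -
    have "sqrt s \<le> p" using assms by (simp add: real_le_lsqrt)
    then have "1 / p \<le> 1 / sqrt s" using assms by (intro divide_left_mono) auto
    moreover have "2 / sqrt (8 * s) \<le> 2 / sqrt (4 * s)" using assms by (intro divide_left_mono) auto
    ultimately show ?thesis by simp
  qed
  also have "\<dots> \<le> 3 / sqrt s" using assms by (simp add: real_sqrt_mult divide_simps)
  finally show ?thesis .
qed

text \<open>
  The entropy is at least the logarithm of the inverse of the largest point mass.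
\<close>
lemma coord_entropy_lower:
  assumes "p > 0" "0 < s" "s \<le> (real p)\<^sup>2"
  shows "ln s / 2 - ln 3 \<le> coord_entropy w p s"
proof -
  have "- ln (3 / sqrt s) \<le> coord_entropy w p s"
    unfolding coord_entropy_def using assms
    by (intro density_entropy_ge_max prob_density_coord_density coord_density_le) auto
  then show ?thesis using assms by (simp add: ln_div ln_sqrt)
qed

lemma expectation_root_char:
  assumes "p \<ge> 2" "s \<ge> 0"
  shows "(\<Sum>x\<in>{0..<int p}. complex_of_real (coord_density w p s x) * root_char p x) = multiplier w p s 1"
  using fourier_series_coeff[of p 1 "multiplier w p s"] assms by (simp add: coord_density_fourier)

text \<open>
  A quantitative form of the fact that only the uniform density has full entropy. The reference in
  the Gibbs inequality is the uniform density tilted by \<open>1 + f\<close>, where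
  \<open>f\<close> is a small multiple of the first character turned into the direction of the
  Fourier coefficient \<open>a\<close>. The mean of \<open>f\<close> under the walk is
  \<open>|a|\<^sup>2 / 4\<close>, and the factor \<open>1 / 4\<close> makes this twice the second
  order term.
\<close>
lemma entropy_gap_ge_fourier_coeff:
  assumes "p \<ge> 2" "s \<ge> 0"
  shows "(norm (multiplier w p s 1))\<^sup>2 / 8 \<le> entropy_gap w p s"
proof -
  let ?Z = "{0..<int p}" and ?q = "coord_density w p s"
  define a where "a = multiplier w p s 1"
  define f where "f x = Re (cnj a * root_char p x) / 4" for x
  have p: "p > 0" using assms by simp
  note q = prob_density_coord_density[OF p, of w s]
  have "norm a \<le> 1"
    using assms cos_le_one[of "2 * pi * of_int 1 / p"]
    by (simp add: a_def norm_multiplier mult_nonneg_nonneg)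
  have f: "\<bar>f x\<bar> \<le> norm a / 4" for x
    using abs_Re_le_cmod[of "cnj a * root_char p x"] by (simp add: f_def norm_mult)
  have f': "\<bar>f x\<bar> \<le> 1 / 4" for x using f[of x] \<open>norm a \<le> 1\<close> by linarith
  then have pos: "0 < 1 + f x" for x by (smt (verit, best) divide_less_eq_1)
  have "(\<Sum>x\<in>?Z. root_char p x) = 0"
    using sum_root_char[OF p, of 1] assms by (simp add: zdvd1_eq)
  then have sum_f: "(\<Sum>x\<in>?Z. f x) = 0"
    by (simp add: f_def sum_divide_distrib[symmetric] Re_sum[symmetric] sum_distrib_left[symmetric] del: Re_sum times_complex.sel)
  have "(\<Sum>x\<in>?Z. ?q x * f x) = Re (cnj a * (\<Sum>x\<in>?Z. complex_of_real (?q x) * root_char p x)) / 4"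
    by (simp add: f_def sum_distrib_left sum_divide_distrib algebra_simps)
  also have "\<dots> = (norm a)\<^sup>2 / 4"
    unfolding expectation_root_char[OF assms] a_def[symmetric] cmod_power2 by (simp add: power2_eq_square)
  finally have mean_f: "(\<Sum>x\<in>?Z. ?q x * f x) = (norm a)\<^sup>2 / 4" .
  have "coord_entropy w p s \<le> (\<Sum>x\<in>?Z. - ?q x * ln ((1 + f x) / p))"
    unfolding coord_entropy_def
    using p sum_f pos by (intro gibbs_inequality q) (auto simp: sum_divide_distrib[symmetric] sum.distrib)
  also have "\<dots> = (\<Sum>x\<in>?Z. ?q x * ln p - ?q x * ln (1 + f x))"
  proof (intro sum.cong refl)
    fix x
    have "ln ((1 + f x) / p) = ln (1 + f x) - ln p" using p pos[of x] by (simp add: ln_div)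
    then show "- ?q x * ln ((1 + f x) / p) = ?q x * ln p - ?q x * ln (1 + f x)"
      by (simp only: right_diff_distrib mult_minus_left minus_diff_eq)
  qed
  also have "\<dots> = ln p - (\<Sum>x\<in>?Z. ?q x * ln (1 + f x))"
    using prob_densityD(3)[OF q] by (simp add: sum_subtractf sum_distrib_right[symmetric])
  finally have 1: "(\<Sum>x\<in>?Z. ?q x * ln (1 + f x)) \<le> entropy_gap w p s"
    by (simp add: entropy_gap_def)
  have "(\<Sum>x\<in>?Z. ?q x * f x - ?q x * ((norm a)\<^sup>2 / 8)) \<le> (\<Sum>x\<in>?Z. ?q x * ln (1 + f x))"
  proof (rule sum_mono)
    fix x
    have "\<bar>ln (1 + f x) - f x\<bar> \<le> 2 * (f x)\<^sup>2"
      using f'[of x] by (intro abs_ln_one_plus_x_minus_x_bound) auto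
    moreover have "\<bar>f x\<bar>\<^sup>2 \<le> (norm a / 4)\<^sup>2" using f by (intro power_mono) auto
    ultimately have "f x - (norm a)\<^sup>2 / 8 \<le> ln (1 + f x)" by (simp add: power_divide)
    then have "?q x * (f x - (norm a)\<^sup>2 / 8) \<le> ?q x * ln (1 + f x)"
      using prob_densityD(2)[OF q] by (intro mult_left_mono)
    then show "?q x * f x - ?q x * ((norm a)\<^sup>2 / 8) \<le> ?q x * ln (1 + f x)"
      by (simp only: right_diff_distrib)
  qed
  moreover have "(\<Sum>x\<in>?Z. ?q x * f x - ?q x * ((norm a)\<^sup>2 / 8)) = (norm a)\<^sup>2 / 8"
    using mean_f prob_densityD(3)[OF q] by (simp add: sum_subtractf sum_distrib_right[symmetric] del: times_divide_eq_right)
  ultimately show ?thesis using 1 by (simp add: a_def)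
qed

text \<open>
  Bounds the gap below through the modulus \<open>exp (- s (1 - cos (2 \<pi> / p)))\<close> of the
  first multiplier.
\<close>
lemma entropy_gap_lower:
  assumes "p \<ge> 2" "s \<ge> 0"
  shows "exp (- 4 * pi\<^sup>2 * s / (real p)\<^sup>2) / 8 \<le> entropy_gap w p s"
proof -
  have "1 - cos (2 * pi * of_int 1 / p) \<le> 2 * pi\<^sup>2 / (real p)\<^sup>2"
    using one_minus_cos_le[of "2 * pi / p"] by (simp add: power_divide power_mult_distrib)
  then have "s * (1 - cos (2 * pi * of_int 1 / p)) \<le> s * (2 * pi\<^sup>2 / (real p)\<^sup>2)"
    using assms by (intro mult_left_mono) auto
  then have "exp (- (s * (2 * pi\<^sup>2 / (real p)\<^sup>2))) \<le> norm (multiplier w p s 1)"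
    by (simp add: norm_multiplier)
  then have "(exp (- (s * (2 * pi\<^sup>2 / (real p)\<^sup>2))))\<^sup>2 \<le> (norm (multiplier w p s 1))\<^sup>2"
    by (intro power_mono) auto
  also have "(exp (- (s * (2 * pi\<^sup>2 / (real p)\<^sup>2))))\<^sup>2 = exp (- 4 * pi\<^sup>2 * s / (real p)\<^sup>2)"
    by (simp add: exp_double[symmetric] algebra_simps)
  finally show ?thesis using entropy_gap_ge_fourier_coeff[OF assms, of w] by simp
qed

text \<open>
  The squared distance is at most \<open>(p\<^sup>2 / 8) (1 - cos (2 \<pi> x / p))\<close>, whose
  expectation is read off from the first Fourier coefficient. For the directed walk the drift
  makes such a bound false.
\<close>
lemma mean_square_dist_le:
  assumes "p \<ge> 2" "s \<ge> 0"
  shows "(\<Sum>x\<in>{0..<int p}. coord_density Simple p s x * (circ_dist p x)\<^sup>2) \<le> 4 * s"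
proof -
  let ?Z = "{0..<int p}" and ?q = "coord_density Simple p s"
  have p: "p > 0" using assms by simp
  note q = prob_density_coord_density[OF p, of Simple s]
  define c where "c = 1 - cos (2 * pi / p)"
  have c: "c \<le> 2 * pi\<^sup>2 / (real p)\<^sup>2"
    using one_minus_cos_le[of "2 * pi / p"] by (simp add: c_def power_divide power_mult_distrib)
  have "(\<Sum>x\<in>?Z. ?q x * (circ_dist p x)\<^sup>2) \<le> (\<Sum>x\<in>?Z. (real p)\<^sup>2 / 8 * (?q x * (1 - cos (2 * pi * of_int x / p))))"
  proof (rule sum_mono)
    fix x assume "x \<in> ?Z"
    then have "(circ_dist p x)\<^sup>2 \<le> (real p)\<^sup>2 / 8 * (1 - cos (2 * pi * of_int x / p))"
      using one_minus_cos_ge[of x p] p by (simp add: field_simps)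
    then have "?q x * (circ_dist p x)\<^sup>2 \<le> ?q x * ((real p)\<^sup>2 / 8 * (1 - cos (2 * pi * of_int x / p)))"
      using prob_densityD(2)[OF q] by (intro mult_left_mono)
    then show "?q x * (circ_dist p x)\<^sup>2 \<le> (real p)\<^sup>2 / 8 * (?q x * (1 - cos (2 * pi * of_int x / p)))"
      by (simp only: mult.left_commute)
  qed
  also have "\<dots> = (real p)\<^sup>2 / 8 * (\<Sum>x\<in>?Z. ?q x * (1 - cos (2 * pi * of_int x / p)))"
    by (simp only: sum_distrib_left)
  also have "(\<Sum>x\<in>?Z. ?q x * (1 - cos (2 * pi * of_int x / p))) = 1 - Re (multiplier Simple p s 1)"
    using arg_cong[OF expectation_root_char[OF assms, of Simple], of Re] prob_densityD(3)[OF q]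
    by (simp add: right_diff_distrib sum_subtractf root_char_def)
  also have "Re (multiplier Simple p s 1) = exp (- s * c)"
    by (simp add: multiplier_def increment_char_simps c_def Re_exp algebra_simps)
  also have "(real p)\<^sup>2 / 8 * (1 - exp (- s * c)) \<le> (real p)\<^sup>2 / 8 * (s * (2 * pi\<^sup>2 / (real p)\<^sup>2))"
  proof (rule mult_left_mono)
    have "1 - exp (- s * c) \<le> s * c" using exp_ge_add_one_self[of "- s * c"] by simp
    also have "\<dots> \<le> s * (2 * pi\<^sup>2 / (real p)\<^sup>2)" using c assms by (intro mult_left_mono)
    finally show "1 - exp (- s * c) \<le> s * (2 * pi\<^sup>2 / (real p)\<^sup>2)" .
  qed simp
  also have "\<dots> = pi\<^sup>2 / 4 * s" using p by simp
  also have "\<dots> \<le> 4 * s"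
  proof (rule mult_right_mono)
    have "pi\<^sup>2 \<le> 4\<^sup>2" using pi_less_4 by (intro power_mono) auto
    then show "pi\<^sup>2 / 4 \<le> 4" by simp
  qed (use assms in simp)
  finally show ?thesis .
qed

text \<open>
  The Gibbs inequality with a two-sided geometric law as reference.
\<close>
lemma entropy_le_mean_dist:
  assumes "p \<ge> 2" "a > 0"
  shows "coord_entropy w p s \<le> a * (\<Sum>x\<in>{0..<int p}. coord_density w p s x * circ_dist p x) + ln (1 + 2 / a)"
proof -
  let ?Z = "{0..<int p}" and ?q = "coord_density w p s"
  have p: "p > 0" using assms by simp
  note q = prob_density_coord_density[OF p, of w s]
  define K where "K = 1 + 2 / a"
  have K: "0 < K" using assms by (simp add: K_def add_pos_pos)
  have "coord_entropy w p s \<le> (\<Sum>x\<in>?Z. - ?q x * ln (exp (- a * circ_dist p x) / K))"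
    unfolding coord_entropy_def
    using K sum_exp_circ_dist_le[OF assms(2), of p]
    by (intro gibbs_inequality q) (auto simp: sum_divide_distrib[symmetric] K_def)
  also have "\<dots> = (\<Sum>x\<in>?Z. a * (?q x * circ_dist p x) + ?q x * ln K)"
    using K by (intro sum.cong refl) (simp add: ln_div algebra_simps)
  also have "\<dots> = a * (\<Sum>x\<in>?Z. ?q x * circ_dist p x) + ln K"
    using prob_densityD(3)[OF q] by (simp add: sum.distrib sum_distrib_left[symmetric] sum_distrib_right[symmetric])
  finally show ?thesis by (simp add: K_def)
qed

text \<open>
  Adding independent noise does not decrease the entropy, and adding a reflected copy of the
  directed walk removes its drift. So upper bounds for the simple walk, which rest on its small
  mean square distance, carry over to the directed walk.
\<close>
lemma coord_entropy_le_simple: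
  assumes "p > 0" "s \<ge> 0"
  shows "coord_entropy w p s \<le> coord_entropy Simple p (2 * s)"
proof (cases w)
  case Simple
  then show ?thesis
    using density_entropy_conv_ge[OF assms(1) prob_density_coord_density[OF assms(1), of Simple s] prob_density_coord_density[OF assms(1), of Simple s]]
    by (simp only: coord_entropy_def mult_2 coord_density_add[OF assms(1,2,2)])
next
  case Directed
  have refl: "prob_density p (\<lambda>x. coord_density Directed p s (- x))"
  proof -
    note q = prob_density_coord_density[OF assms(1), of Directed s]
    have "(\<Sum>x\<in>{0..<int p}. coord_density Directed p s (0 - x)) = 1"
      using sum_periodic_reflect[OF assms(1) prob_densityD(1)[OF q], of 0] prob_densityD(3)[OF q] by simp
    moreover have "periodic p (\<lambda>x. coord_density Directed p s (- x))"
      by (simp add: periodic_def coord_density_def mod_minus_eq)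
    ultimately show ?thesis using prob_densityD(2)[OF q] by (simp add: prob_density_def)
  qed
  then show ?thesis
    using density_entropy_conv_ge[OF assms(1) prob_density_coord_density[OF assms(1), of Directed s] refl]
    by (simp add: coord_entropy_def Directed simple_eq_conv_directed[OF assms])
qed

text \<open>
  Suited to short times: choosing \<open>a\<close> large shows that the entropy is small,
  uniformly in \<open>p\<close>.
\<close>
lemma coord_entropy_upper_linear:
  assumes "p \<ge> 2" "a > 0" "s \<ge> 0"
  shows "coord_entropy w p s \<le> 8 * a * s + ln (1 + 2 / a)"
proof -
  let ?Z = "{0..<int p}" and ?q = "coord_density Simple p (2 * s)"
  have p: "p > 0" using assms by simp
  note q = prob_density_coord_density[OF p, of Simple "2 * s"]
  have "(\<Sum>x\<in>?Z. ?q x * circ_dist p x) \<le> (\<Sum>x\<in>?Z. ?q x * (circ_dist p x)\<^sup>2)"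
    by (intro sum_mono mult_left_mono circ_dist_le_square prob_densityD(2)[OF q])
  also have "\<dots> \<le> 4 * (2 * s)" using assms by (intro mean_square_dist_le) auto
  finally have "a * (\<Sum>x\<in>?Z. ?q x * circ_dist p x) \<le> a * (8 * s)" using assms(2) by simp
  then show ?thesis
    using entropy_le_mean_dist[OF assms(1,2), of Simple "2 * s"] coord_entropy_le_simple[OF p assms(3), of w]
    by simp
qed

text \<open>
  The choice \<open>a = 1 / sqrt s\<close>, with the mean distance bounded through the mean square
  distance.
\<close>
lemma coord_entropy_upper_log:
  assumes "p \<ge> 2" "s > 0"
  shows "coord_entropy w p s \<le> 5 + ln (1 + 2 * sqrt s)"
proof -
  let ?Z = "{0..<int p}" and ?q = "coord_density Simple p (2 * s)"
  have p: "p > 0" using assms by simp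
  note q = prob_density_coord_density[OF p, of Simple "2 * s"]
  define m where "m = sqrt s"
  have m: "0 < m" "m\<^sup>2 = s" using assms by (auto simp: m_def)
  have "(\<Sum>x\<in>?Z. ?q x * circ_dist p x) \<le> (\<Sum>x\<in>?Z. ?q x * (circ_dist p x)\<^sup>2 / (2 * m) + ?q x * (m / 2))"
  proof (rule sum_mono)
    fix x
    have "0 \<le> (circ_dist p x - m)\<^sup>2" by simp
    then have "circ_dist p x \<le> (circ_dist p x)\<^sup>2 / (2 * m) + m / 2"
      using m by (simp add: power2_diff field_simps power2_eq_square)
    then have "?q x * circ_dist p x \<le> ?q x * ((circ_dist p x)\<^sup>2 / (2 * m) + m / 2)"
      using prob_densityD(2)[OF q] by (intro mult_left_mono)
    then show "?q x * circ_dist p x \<le> ?q x * (circ_dist p x)\<^sup>2 / (2 * m) + ?q x * (m / 2)"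
      by (simp add: distrib_left)
  qed
  also have "\<dots> = (\<Sum>x\<in>?Z. ?q x * (circ_dist p x)\<^sup>2) / (2 * m) + m / 2"
    using prob_densityD(3)[OF q]
    by (simp add: sum.distrib sum_divide_distrib[symmetric] sum_distrib_right[symmetric] del: times_divide_eq_right)
  also have "\<dots> \<le> 4 * (2 * s) / (2 * m) + m / 2"
    using assms m by (intro add_right_mono divide_right_mono mean_square_dist_le) auto
  also have "\<dots> \<le> 5 * m" using m by (simp add: power2_eq_square flip: m(2))
  finally have "1 / m * (\<Sum>x\<in>?Z. ?q x * circ_dist p x) \<le> 1 / m * (5 * m)"
    using m by (intro mult_left_mono) auto
  then have "coord_entropy Simple p (2 * s) \<le> 5 + ln (1 + 2 * m)"
    using entropy_le_mean_dist[of p "1 / m" Simple "2 * s"] assms m by simp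
  then show ?thesis
    using coord_entropy_le_simple[OF p, of s w] assms by (simp add: m_def)
qed


section \<open>From entropy multiplier to cutoff times\<close>

text \<open>
  The lower bound on \<open>- u D' u\<close>, up to a constant, in terms of the entropy gap
  \<open>D\<close>. For a small gap it is \<open>D ln (1 / D)\<close>, as for \<open>D = exp (- u
  / p\<^sup>2)\<close>; for a large one it is \<open>1\<close>, as for \<open>D = ln p - ln u /
  2\<close>.
\<close>
definition mixing_rate :: "real \<Rightarrow> real" where
  "mixing_rate D = min D 1 * ln (max (1 / D) (exp 1))"

lemma one_le_ln_max_exp: "1 \<le> ln (max (x::real) (exp 1))"
proof -
  have "exp 1 \<le> max x (exp 1)" by simp
  then have "ln (exp 1) \<le> ln (max x (exp 1))"
    by (subst ln_le_cancel_iff) (auto simp: less_max_iff_disj)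
  then show ?thesis by simp
qed

lemma mixing_rate_le_1:
  assumes "0 < D"
  shows "mixing_rate D \<le> 1"
proof (cases "1 / D \<le> exp 1")
  case True
  then show ?thesis by (simp add: mixing_rate_def max_absorb2)
next
  case False
  have "D < 1"
  proof (rule ccontr)
    assume "\<not> D < 1"
    then have "1 / D \<le> 1" by simp
    also have "1 \<le> exp (1::real)" by simp
    finally show False using False by simp
  qed
  moreover have "ln (1 / D) \<le> 1 / D - 1" using assms by (intro ln_le_minus_one) auto
  then have "D * ln (1 / D) \<le> D * (1 / D - 1)" using assms by (intro mult_left_mono) auto
  ultimately show ?thesis using False assms
    by (simp add: mixing_rate_def max_absorb1 right_diff_distrib)
qed

lemma entropy_gap_pos:
  assumes "p \<ge> 2" "s \<ge> 0"
  shows "0 < entropy_gap w p s"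
  using entropy_gap_lower[OF assms, of w] by (smt (verit) exp_gt_zero divide_pos_pos)

lemma log_inverse_entropy_gap_le:
  assumes "p \<ge> 2" "s \<ge> 0"
  shows "(real p)\<^sup>2 * ln (max (1 / entropy_gap w p s) (exp 1)) \<le> 3 * (real p)\<^sup>2 + 64 * s"
proof -
  let ?D = "entropy_gap w p s"
  have D: "0 < ?D" using assms by (rule entropy_gap_pos)
  have "1 / ?D \<le> 8 * exp (4 * pi\<^sup>2 * s / (real p)\<^sup>2)"
  proof -
    have "exp (4 * pi\<^sup>2 * s / (real p)\<^sup>2) * (exp (- 4 * pi\<^sup>2 * s / (real p)\<^sup>2) / 8)
        \<le> exp (4 * pi\<^sup>2 * s / (real p)\<^sup>2) * ?D"
      using entropy_gap_lower[OF assms, of w] by (intro mult_left_mono) auto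
    then show ?thesis using D by (simp add: exp_add[symmetric] field_simps)
  qed
  also have "8 \<le> exp (3::real)"
  proof -
    have "2 ^ 3 \<le> exp (1::real) ^ 3" using exp_ge_add_one_self[of 1] by (intro power_mono) auto
    then show ?thesis by (simp add: exp_of_nat_mult[symmetric])
  qed
  finally have "1 / ?D \<le> exp (3 + 4 * pi\<^sup>2 * s / (real p)\<^sup>2)" by (simp add: exp_add)
  moreover have "exp 1 \<le> exp (3 + 4 * pi\<^sup>2 * s / (real p)\<^sup>2)" using assms by simp
  ultimately have "max (1 / ?D) (exp 1) \<le> exp (3 + 4 * pi\<^sup>2 * s / (real p)\<^sup>2)" by simp
  then have "ln (max (1 / ?D) (exp 1)) \<le> ln (exp (3 + 4 * pi\<^sup>2 * s / (real p)\<^sup>2))"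
    by (subst ln_le_cancel_iff) (auto simp: less_max_iff_disj)
  then have "(real p)\<^sup>2 * ln (max (1 / ?D) (exp 1)) \<le> (real p)\<^sup>2 * (3 + 4 * pi\<^sup>2 * s / (real p)\<^sup>2)"
    by (intro mult_left_mono) auto
  also have "\<dots> = 3 * (real p)\<^sup>2 + 4 * pi\<^sup>2 * s" using assms by (simp add: distrib_left)
  also have "\<dots> \<le> 3 * (real p)\<^sup>2 + 64 * s"
  proof -
    have "pi\<^sup>2 \<le> 4\<^sup>2" using pi_less_4 by (intro power_mono) auto
    then have "pi\<^sup>2 * s \<le> 16 * s" using assms by (intro mult_right_mono) auto
    then show ?thesis by linarith
  qed
  finally show ?thesis .
qed

text \<open>
  The choice \<open>a = 4 / c\<close> makes the logarithmic term in the linear bound at most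
  \<open>c / 2\<close>.
\<close>
lemma time_lower_bound:
  assumes "c > 0" "p \<ge> 2" "u \<ge> 0" "c \<le> coord_entropy w p u"
  shows "c\<^sup>2 / 64 \<le> u"
proof -
  have "coord_entropy w p u \<le> 8 * (4 / c) * u + ln (1 + 2 / (4 / c))"
    using assms by (intro coord_entropy_upper_linear) auto
  also have "ln (1 + 2 / (4 / c)) \<le> 2 / (4 / c)" using assms by (intro ln_add_one_self_le_self) auto
  finally have "c / 2 \<le> 32 * u / c" using assms by simp
  then show ?thesis using assms by (simp add: field_simps power2_eq_square)
qed

text \<open>
  The central estimate, uniform in \<open>p\<close> and in the walk: from every time
  \<open>u\<close> at which the entropy is at least \<open>c\<close>, some chord of the gap to a
  later time has slope at least \<open>mixing_rate (D u) / (C u)\<close> in modulus.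
\<close>
lemma entropy_gap_drops:
  assumes "c > 0"
  obtains C where "C > 0" "\<And>w p u. p \<ge> 2 \<Longrightarrow> u \<ge> 0 \<Longrightarrow> c \<le> coord_entropy w p u \<Longrightarrow>
    \<exists>S>u. (S - u) * mixing_rate (entropy_gap w p u) \<le> C * u * (entropy_gap w p u - entropy_gap w p S)"
proof -
  define K where "K = 2 + 8 / c"
  have K: "2 < K" using assms by (simp add: K_def)
  \<comment> \<open>Chosen so that \<open>ln M / 2\<close> exceeds by \<open>1\<close> the sum of the bounded terms in the lower and the upper bound on the entropy.\<close>
  define M where "M = exp (2 * (6 + ln 3 + ln K))"
  have M: "1 < M" "ln M = 2 * (6 + ln 3 + ln K)" using K by (auto simp: M_def add_pos_pos)
  define C where "C = 6 * M + 128"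
  have "\<exists>S>u. (S - u) * mixing_rate (entropy_gap w p u) \<le> C * u * (entropy_gap w p u - entropy_gap w p S)"
    if p: "p \<ge> 2" and u: "u \<ge> 0" "c \<le> coord_entropy w p u" for w p u
  proof -
    define D where "D = entropy_gap w p u"
    have D: "0 < D" using p u by (simp add: D_def entropy_gap_pos)
    have "(c / 8)\<^sup>2 \<le> u" using time_lower_bound[OF assms p u] by (simp add: power_divide)
    moreover have "0 < (c / 8)\<^sup>2" using assms by simp
    ultimately have u0: "0 < u" "c / 8 \<le> sqrt u"
      by (linarith, intro real_le_rsqrt)
    show ?thesis
    proof (cases "M * u \<le> (real p)\<^sup>2")
      case True
      have "1 + 2 * sqrt u \<le> K * sqrt u"
        using u0 assms by (simp add: K_def distrib_right field_simps)
      then have "ln (1 + 2 * sqrt u) \<le> ln (K * sqrt u)"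
        using u0 K by (subst ln_le_cancel_iff) (auto intro: add_pos_nonneg)
      then have "coord_entropy w p u \<le> 5 + ln K + ln u / 2"
        using coord_entropy_upper_log[OF p u0(1), of w] u0 K by (simp add: ln_mult ln_sqrt)
      moreover have "ln (M * u) / 2 - ln 3 \<le> coord_entropy w p (M * u)"
        using p u0 M True by (intro coord_entropy_lower) auto
      moreover have "ln (M * u) = ln M + ln u" using M u0 by (simp add: ln_mult)
      moreover have "(2 * (6 + ln 3 + ln K) + ln u) / 2 - ln 3 = 6 + ln K + ln u / 2"
        by (simp add: field_simps)
      ultimately have drop: "1 \<le> D - entropy_gap w p (M * u)"
        unfolding D_def entropy_gap_def M(2) by simp
      have "(M * u - u) * mixing_rate D \<le> (M * u - u) * 1"
        using M u0 mixing_rate_le_1[OF D] by (intro mult_left_mono) auto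
      also have "\<dots> \<le> C * u * 1" using M u0 by (simp add: C_def algebra_simps)
      also have "\<dots> \<le> C * u * (D - entropy_gap w p (M * u))"
        using M u0 drop by (intro mult_left_mono) (auto simp: C_def)
      finally show ?thesis using M u0 by (intro exI[of _ "M * u"]) (auto simp: D_def)
    next
      case False
      have half: "D / 2 \<le> D - entropy_gap w p (u + (real p)\<^sup>2)"
        using entropy_gap_halves[of p u w] p u by (simp add: D_def)
      have "(real p)\<^sup>2 * mixing_rate D \<le> D * ((real p)\<^sup>2 * ln (max (1 / D) (exp 1)))"
      proof -
        have "min D 1 * ln (max (1 / D) (exp 1)) \<le> D * ln (max (1 / D) (exp 1))"
          using one_le_ln_max_exp[of "1 / D"] by (intro mult_right_mono) auto
        then have "(real p)\<^sup>2 * mixing_rate D \<le> (real p)\<^sup>2 * (D * ln (max (1 / D) (exp 1)))"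
          unfolding mixing_rate_def by (intro mult_left_mono) auto
        then show ?thesis by (simp only: mult.left_commute)
      qed
      also have "\<dots> \<le> D * (3 * (real p)\<^sup>2 + 64 * u)"
        unfolding D_def using p u D
        by (intro mult_left_mono log_inverse_entropy_gap_le) (auto simp: D_def)
      also have "\<dots> \<le> D * (3 * (M * u) + 64 * u)"
        using False D by (intro mult_left_mono) auto
      also have "\<dots> = C * u * (D / 2)" by (simp add: C_def algebra_simps)
      also have "\<dots> \<le> C * u * (D - entropy_gap w p (u + (real p)\<^sup>2))"
        using half M u0 by (intro mult_left_mono) (auto simp: C_def)
      finally show ?thesis using p by (intro exI[of _ "u + (real p)\<^sup>2"]) (auto simp: D_def)
    qed
  qed
  then show ?thesis using that[of C] M by (auto simp: C_def)
qed

lemma entropy_gap_three_chord: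
  assumes "p > 0" "0 \<le> s" "s < u" "u < S"
  shows "(u - s) * (entropy_gap w p u - entropy_gap w p S) \<le> (S - u) * (entropy_gap w p s - entropy_gap w p u)"
proof -
  let ?D = "entropy_gap w p"
  have "(?D s - ?D u) / (s - u) \<le> (?D u - ?D S) / (u - S)"
    using convex_on_slope_le[OF convex_entropy_gap[OF assms(1)], of s S u w] assms by (auto intro: order_trans)
  then show ?thesis using assms by (simp add: field_simps)
qed

text \<open>
  Since the gap is positive and will be halved, the chord from \<open>u\<close> to \<open>u +
  p\<^sup>2\<close> is strictly decreasing; by convexity, so is each earlier one.
\<close>
lemma entropy_gap_strict_antimono:
  assumes "p \<ge> 2" "0 \<le> s" "s < u"
  shows "entropy_gap w p u < entropy_gap w p s"
proof -
  let ?D = "entropy_gap w p" and ?S = "u + (real p)\<^sup>2"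
  have p: "p > 0" using assms by simp
  have "0 < ?D u" using assms by (intro entropy_gap_pos) auto
  moreover have "?D ?S \<le> ?D u / 2" using assms p by (intro entropy_gap_halves) auto
  ultimately have "0 < (u - s) * (?D u - ?D ?S)" using assms by simp
  also have "\<dots> \<le> (?S - u) * (?D s - ?D u)"
    using assms p by (intro entropy_gap_three_chord) auto
  finally show ?thesis using p by (simp add: zero_less_mult_iff)
qed

lemma entropy_gap_attained:
  assumes "p \<ge> 2" "0 < v" "v \<le> ln p"
  shows "\<exists>!s. 0 \<le> s \<and> entropy_gap w p s = v"
proof -
  let ?D = "entropy_gap w p"
  have p: "p > 0" using assms by simp
  have D0: "?D 0 = ln p" using p by (simp add: entropy_gap_def coord_entropy_0)
  have multiplier: "?D (real n * (real p)\<^sup>2) \<le> ln p * (1 / 2) ^ n" for n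
  proof (induction n)
    case (Suc n)
    have "?D (real (Suc n) * (real p)\<^sup>2) = ?D (real n * (real p)\<^sup>2 + (real p)\<^sup>2)"
      by (simp add: algebra_simps)
    also have "\<dots> \<le> ?D (real n * (real p)\<^sup>2) / 2" using p by (intro entropy_gap_halves) auto
    finally show ?case using Suc by simp
  qed (simp add: D0)
  have "(\<lambda>n. ln p * (1 / 2) ^ n) \<longlonglongrightarrow> ln p * 0"
    by (intro tendsto_mult tendsto_const LIMSEQ_realpow_zero) auto
  then have "eventually (\<lambda>n. ln p * (1 / 2) ^ n < v) sequentially"
    using assms(2) by (intro order_tendstoD(2)) auto
  then obtain n where "ln p * (1 / 2) ^ n < v" by (auto simp: eventually_sequentially)
  then have "?D (real n * (real p)\<^sup>2) \<le> v" using multiplier[of n] by simp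
  then obtain s where "0 \<le> s" "?D s = v"
    using IVT2'[of ?D "real n * (real p)\<^sup>2" v 0] assms D0
      continuous_on_subset[OF continuous_entropy_gap[OF p], of "{0..real n * (real p)\<^sup>2}" w]
    by auto
  moreover have "s' = s" if "0 \<le> s'" "?D s' = v" for s'
    using entropy_gap_strict_antimono[OF assms(1), of s s' w] entropy_gap_strict_antimono[OF assms(1), of s' s w]
      that calculation by (cases s s' rule: linorder_cases) auto
  ultimately show ?thesis by blast
qed

text \<open>
  As soon as the target \<open>v\<close> for the gap lies in \<open>(0, ln p]\<close>, the
  definite description in the cutoff time is well defined, and it is the time at which the gap of
  one coordinate equals \<open>v\<close>.
\<close>
lemma cutoff_time_spec:
  assumes "p \<ge> 2" "k > 0"
    and v: "v = zeta d p k - 2 * \<alpha> * sqrt (real k * min (zeta d p k) 1) / k"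
    and "0 < v" "v \<le> ln p"
  shows "0 \<le> cutoff_time w d p k \<alpha>" "entropy_gap w p (cutoff_time w d p k \<alpha> / k) = v"
proof -
  have p: "p > 0" using assms by simp
  let ?T = "real d * ln p + 2 * \<alpha> * sqrt (real k * min (zeta d p k) 1)"
  have "k * v = k * ln p - ?T"
    using assms(2) by (simp add: v zeta_def field_simps)
  then have iff: "walk_entropy w p k t = ?T \<longleftrightarrow> entropy_gap w p (t / k) = v" if "t \<ge> 0" for t
    using assms(2) walk_entropy_eq_coord_entropy[OF p assms(2) that, of w]
    by (simp add: entropy_gap_def) (smt (verit, best) mult_cancel_left of_nat_0_less_iff right_diff_distrib)
  obtain s where s: "0 \<le> s" "entropy_gap w p s = v" "\<And>s'. 0 \<le> s' \<Longrightarrow> entropy_gap w p s' = v \<Longrightarrow> s' = s"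
    using entropy_gap_attained[OF assms(1,4,5), of w] by blast
  have "cutoff_time w d p k \<alpha> = k * s"
    unfolding cutoff_time_def
  proof (rule the_equality)
    show "0 \<le> k * s \<and> walk_entropy w p k (k * s) = ?T"
      using s(1,2) iff[of "k * s"] assms(2) by simp
    show "t = k * s" if "0 \<le> t \<and> walk_entropy w p k t = ?T" for t
    proof -
      have "t / k = s" using s(3)[of "t / k"] iff[of t] that by simp
      then show ?thesis using assms(2) by (simp add: field_simps)
    qed
  qed
  then show "0 \<le> cutoff_time w d p k \<alpha>" "entropy_gap w p (cutoff_time w d p k \<alpha> / k) = v"
    using s(1,2) assms(2) by auto
qed

text \<open>
  The non-asymptotic form of the result. The times \<open>s\<close> and \<open>u\<close> in the
  proof are those of one coordinate for parameters \<open>0\<close> and \<open>\<alpha>\<close>.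
  The chord estimate is applied at the later of the two: for \<open>\<alpha> < 0\<close> this is
  \<open>s\<close>, where the gap is \<open>\<zeta>\<close>. For \<open>\<alpha> > 0\<close> it is
  \<open>u\<close>, where the gap is still at least \<open>\<zeta> / 2\<close>; the estimate then
  bounds \<open>u - s\<close> relative to \<open>u\<close>, and \<open>u \<le> 2 s\<close> for
  large \<open>k min \<zeta> 1\<close>.
\<close>
lemma cutoff_time_difference:
  fixes \<alpha> c :: real
  assumes "c > 0"
  obtains C B where "C > 0" "B > 0"
    "\<And>w d p k. p \<ge> 2 \<Longrightarrow> d < k \<Longrightarrow> c * k \<le> d * ln p \<Longrightarrow> B \<le> k * min (zeta d p k) 1 \<Longrightarrow>
       0 < cutoff_time w d p k 0 \<and>
       \<bar>cutoff_time w d p k \<alpha> - cutoff_time w d p k 0\<bar>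
         \<le> C * cutoff_time w d p k 0 / (sqrt (k * min (zeta d p k) 1) * ln (max (1 / zeta d p k) (exp 1)))"
proof -
  obtain C0 where C0: "C0 > 0" and drop: "\<And>w p u. p \<ge> 2 \<Longrightarrow> u \<ge> 0 \<Longrightarrow> c \<le> coord_entropy w p u \<Longrightarrow>
    \<exists>S>u. (S - u) * mixing_rate (entropy_gap w p u) \<le> C0 * u * (entropy_gap w p u - entropy_gap w p S)"
    using entropy_gap_drops[OF assms] by blast
  \<comment> \<open>By convexity, the slope of the chord from \<open>u\<close> to \<open>S\<close> bounds the slope of every chord that ends at \<open>u\<close>.\<close>
  have chord: "(u - s) * mixing_rate (entropy_gap w p u) \<le> C0 * u * (entropy_gap w p s - entropy_gap w p u)"
    if asm: "p \<ge> 2" "0 \<le> s" "s < u" "c \<le> coord_entropy w p u" for w p s u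
  proof -
    obtain S where S: "u < S" "(S - u) * mixing_rate (entropy_gap w p u) \<le> C0 * u * (entropy_gap w p u - entropy_gap w p S)"
      using drop[of p u w] asm by auto
    have "(S - u) * ((u - s) * mixing_rate (entropy_gap w p u))
        = (u - s) * ((S - u) * mixing_rate (entropy_gap w p u))" by simp
    also have "\<dots> \<le> (u - s) * (C0 * u * (entropy_gap w p u - entropy_gap w p S))"
      using S that by (intro mult_left_mono) auto
    also have "\<dots> = C0 * u * ((u - s) * (entropy_gap w p u - entropy_gap w p S))" by simp
    also have "\<dots> \<le> C0 * u * ((S - u) * (entropy_gap w p s - entropy_gap w p u))"
      using that S C0 by (intro mult_left_mono entropy_gap_three_chord) auto
    finally have "(S - u) * ((u - s) * mixing_rate (entropy_gap w p u))
        \<le> (S - u) * (C0 * u * (entropy_gap w p s - entropy_gap w p u))" by (simp add: algebra_simps)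
    then show ?thesis using S(1) by (simp add: mult_le_cancel_left_pos)
  qed
  define C where "C = 8 * (\<bar>\<alpha>\<bar> + 1) * C0"
  \<comment> \<open>The summands of \<open>b\<close> serve in turn to get \<open>u \<le> 2 s\<close>, to keep the target within \<open>\<zeta> / 2\<close> of \<open>\<zeta>\<close>, to keep it below
      \<open>ln p\<close>, and to make \<open>b\<close> positive.\<close>
  define b where "b = 8 * \<bar>\<alpha>\<bar> * C0 + 4 * \<bar>\<alpha>\<bar> + 2 * \<bar>\<alpha>\<bar> / c + 1"
  have b: "0 < b" "8 * \<bar>\<alpha>\<bar> * C0 \<le> b" "4 * \<bar>\<alpha>\<bar> \<le> b" "2 * \<bar>\<alpha>\<bar> / c \<le> b"
    using C0 assms by (auto simp: b_def add_nonneg_pos)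
  have main: "0 < cutoff_time w d p k 0 \<and>
       \<bar>cutoff_time w d p k \<alpha> - cutoff_time w d p k 0\<bar>
         \<le> C * cutoff_time w d p k 0 / (sqrt (k * min (zeta d p k) 1) * ln (max (1 / zeta d p k) (exp 1)))"
    if p: "p \<ge> 2" and dk: "d < k" and ck: "c * k \<le> d * ln p" and B: "b\<^sup>2 \<le> k * min (zeta d p k) 1"
    for w d p k
  proof -
    define z m where "z = zeta d p k" and "m = min z 1"
    define L where "L = ln (max (1 / z) (exp 1))"
    define q where "q = sqrt (k * m)"
    have k: "k > 0" using dk by simp
    have p0: "p > 0" "0 < ln p" using p by auto
    have z: "0 < z" using dk p0 by (simp add: z_def zeta_def)
    have m: "0 < m" "m \<le> z" "m \<le> 1" using z by (auto simp: m_def)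
    have L: "1 \<le> L" unfolding L_def by (rule one_le_ln_max_exp)
    have q: "b \<le> q" "0 < q" using B b k m
      by (auto simp: q_def m_def z_def intro!: real_le_rsqrt)
    have qm: "q / k = m / q" using k m by (simp add: q_def field_simps)
    have dln: "real d * ln p / k = ln p - z" using k by (simp add: z_def zeta_def field_simps)
    have "c \<le> real d * ln p / k" using ck k by (simp add: pos_le_divide_eq)
    then have z_le: "z \<le> ln p - c" unfolding dln by simp
    define v where "v = z - 2 * \<alpha> * (m / q)"
    have v: "v = zeta d p k - 2 * \<alpha> * sqrt (real k * min (zeta d p k) 1) / k"
      by (simp add: v_def qm[symmetric]) (simp add: q_def m_def z_def)
    have shift: "2 * \<bar>\<alpha>\<bar> * (m / q) \<le> z / 2"
    proof -
      have "4 * \<bar>\<alpha>\<bar> * m \<le> q * m" using b q m by (intro mult_right_mono) auto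
      also have "\<dots> \<le> q * z" using q m by (intro mult_left_mono) auto
      finally show ?thesis using q by (simp add: field_simps)
    qed
    have shift': "2 * \<bar>\<alpha>\<bar> * (m / q) \<le> c"
    proof -
      have "2 * \<bar>\<alpha>\<bar> \<le> c * q"
        using order_trans[OF b(4) q(1)] assms by (simp add: pos_divide_le_eq mult.commute)
      moreover have "2 * \<bar>\<alpha>\<bar> * m \<le> 2 * \<bar>\<alpha>\<bar> * 1" using m by (intro mult_left_mono) auto
      ultimately have "2 * \<bar>\<alpha>\<bar> * m \<le> c * q" by linarith
      then show ?thesis using q by (simp add: field_simps)
    qed
    have \<alpha>_le: "\<alpha> * (m / q) \<le> \<bar>\<alpha>\<bar> * (m / q)" "- \<alpha> * (m / q) \<le> \<bar>\<alpha>\<bar> * (m / q)"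
      using mult_right_mono[OF abs_ge_self, of "m / q" \<alpha>]
        mult_right_mono[OF abs_ge_minus_self, of "m / q" \<alpha>] m q by auto
    have vb: "z / 2 \<le> v" "v \<le> ln p"
      using shift shift' \<alpha>_le z_le by (simp_all add: v_def)
    have zl: "z \<le> ln p" using z_le assms by simp
    define s where "s = cutoff_time w d p k 0 / k"
    define u where "u = cutoff_time w d p k \<alpha> / k"
    have s: "0 \<le> s" "entropy_gap w p s = z"
      using cutoff_time_spec[of p k z d 0 w] p k z zl by (auto simp: s_def z_def)
    have u: "0 \<le> u" "entropy_gap w p u = v"
      using cutoff_time_spec[OF p k v, of w] vb z k by (auto simp: u_def)
    have Hs: "c \<le> coord_entropy w p s" using s z_le by (simp add: entropy_gap_def)
    have s0: "0 < s"
      using s Hs assms p0 coord_entropy_0[of p w] by (cases "s = 0") auto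
    have bound: "\<bar>u - s\<bar> \<le> C * s / (q * L)"
    proof (cases "\<alpha> = 0")
      case True
      then have "u = s" by (simp add: u_def s_def)
      moreover have "0 \<le> C * s / (q * L)" using s0 C0 q L by (simp add: C_def)
      ultimately show ?thesis by simp
    next
      case False
      show ?thesis
      proof (cases "\<alpha> < 0")
        case True
        have "2 * \<alpha> * (m / q) < 0" using True m q by (intro mult_neg_pos[of "2 * \<alpha>"] divide_pos_pos) auto
        then have "z < v" by (simp add: v_def)
        then have "u < s"
          using entropy_gap_strict_antimono[OF p, of s u w] s u by (cases s u rule: linorder_cases) auto
        then have "(s - u) * mixing_rate z \<le> C0 * s * (v - z)"
          using chord[of p u s w] p u s Hs by simp
        also have "mixing_rate z = m * L" by (simp add: mixing_rate_def m_def L_def)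
        also have "v - z = 2 * \<bar>\<alpha>\<bar> * (m / q)" using True by (simp add: v_def)
        finally have "(s - u) * (q * L) * m \<le> (2 * \<bar>\<alpha>\<bar> * C0) * s * m" using q by (simp add: field_simps)
        then have "(s - u) * (q * L) \<le> (2 * \<bar>\<alpha>\<bar> * C0) * s" using m by (simp add: mult_le_cancel_right)
        also have "\<dots> \<le> C * s" using s0 C0 by (intro mult_right_mono) (auto simp: C_def algebra_simps)
        finally show ?thesis using q L \<open>u < s\<close> by (simp add: pos_le_divide_eq)
      next
        case nneg: False
        then have pos: "0 < \<alpha>" using False by simp
        have "0 < 2 * \<alpha> * (m / q)" using pos m q by (intro mult_pos_pos divide_pos_pos) auto
        then have "v < z" by (simp add: v_def)
        then have su: "s < u"
          using entropy_gap_strict_antimono[OF p, of u s w] s u by (cases s u rule: linorder_cases) auto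
        have "c \<le> coord_entropy w p u" using u \<open>v < z\<close> z_le by (simp add: entropy_gap_def)
        then have "(u - s) * mixing_rate v \<le> C0 * u * (z - v)"
          using chord[of p s u w] p u s su by simp
        moreover have "m / 2 * L \<le> mixing_rate v"
          unfolding mixing_rate_def
        proof (rule mult_mono)
          show "m / 2 \<le> min v 1" using vb m by simp
          have "1 / z \<le> 1 / v" using \<open>v < z\<close> vb z by (intro divide_left_mono) auto
          then show "L \<le> ln (max (1 / v) (exp 1))"
            unfolding L_def by (subst ln_le_cancel_iff) (auto simp: less_max_iff_disj)
        qed (use vb z L in auto)
        then have "(u - s) * (m / 2 * L) \<le> (u - s) * mixing_rate v" using su by (intro mult_left_mono) auto
        moreover have "z - v = 2 * \<alpha> * (m / q)" by (simp add: v_def)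
        ultimately have "(u - s) * (m / 2 * L) \<le> C0 * u * (2 * \<alpha> * (m / q))" by simp
        then have "(u - s) * (q * L) * m \<le> 4 * \<alpha> * C0 * u * m" using q by (simp add: field_simps)
        then have us: "(u - s) * (q * L) \<le> 4 * \<alpha> * C0 * u" using m by (simp add: mult_le_cancel_right)
        have "q * 1 \<le> q * L" using q L by (intro mult_left_mono) auto
        moreover have "8 * \<alpha> * C0 \<le> b" using b(2) pos by simp
        ultimately have qL: "8 * \<alpha> * C0 \<le> q * L" using q(1) by linarith
        have "(u - s) * (8 * \<alpha> * C0) \<le> (u - s) * (q * L)" using su qL by (intro mult_left_mono) auto
        then have "(4 * \<alpha> * C0) * (2 * (u - s)) \<le> (4 * \<alpha> * C0) * u" using us by (simp add: algebra_simps)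
        then have "2 * (u - s) \<le> u" using pos C0 by (simp add: mult_le_cancel_left)
        then have "4 * \<alpha> * C0 * u \<le> 4 * \<alpha> * C0 * (2 * s)" using pos C0 by (intro mult_left_mono) auto
        also have "\<dots> \<le> C * s" using s0 C0 pos by (simp add: C_def algebra_simps)
        finally have "(u - s) * (q * L) \<le> C * s" using us by simp
        then show ?thesis using q L su by (simp add: pos_le_divide_eq)
      qed
    qed
    have t: "cutoff_time w d p k 0 = k * s" "cutoff_time w d p k \<alpha> = k * u"
      using k by (auto simp: s_def u_def)
    have "\<bar>k * u - k * s\<bar> = k * \<bar>u - s\<bar>" by (simp add: right_diff_distrib[symmetric] abs_mult)
    also have "\<dots> \<le> k * (C * s / (q * L))" using bound by (intro mult_left_mono) auto
    finally show ?thesis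
      using s0 k unfolding t by (simp add: q_def L_def m_def z_def mult_ac)
  qed
  show ?thesis by (rule that[of C "b\<^sup>2"]) (use C0 b main in \<open>auto simp: C_def\<close>)
qed

theorem propositionB:
  fixes d p k :: "nat \<Rightarrow> nat"
  assumes "\<And>n. d n \<ge> 1" and "\<And>n. p n \<ge> 2" and "\<And>n. k n > d n"
    and "(\<lambda>_. 1 :: real) \<in> o(\<lambda>n. real (k n))"
    and "(\<lambda>n. real (k n)) \<in> O(\<lambda>n. real (d n) * ln (real (p n)))"
    and "(\<lambda>_. 1 :: real) \<in> o(\<lambda>n. (real (k n) - real (d n)) * real (p n))"
  defines "\<zeta> \<equiv> \<lambda>n. zeta (d n) (p n) (k n)"
    and "t \<equiv> \<lambda>w \<alpha> n. cutoff_time w (d n) (p n) (k n) \<alpha>"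
  shows "\<forall>\<alpha> :: real.
      (\<forall>w. t w \<alpha> \<sim>[sequentially] t w 0) \<and>
      (\<zeta> \<in> O(\<lambda>_. 1) \<longrightarrow>
        (\<forall>w. (\<lambda>n. (t w \<alpha> n - t w 0 n) / t w 0 n) \<in>
              O(\<lambda>n. 1 / (sqrt (\<zeta> n * real (k n)) * ln (max (1 / \<zeta> n) (exp 1)))))) \<and>
      ((\<lambda>_. 1) \<in> o(\<zeta>) \<longrightarrow>
        (\<lambda>n. (t Simple \<alpha> n - t Simple 0 n) / t Simple 0 n) \<in> O(\<lambda>n. 1 / sqrt (real (k n))))"
proof
  fix \<alpha> :: real
  have unbounded: "eventually (\<lambda>n. B \<le> f n) sequentially"
    if "(\<lambda>_. 1 :: real) \<in> o(f)" "\<And>n. 0 \<le> f n" for f :: "nat \<Rightarrow> real" and B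
  proof -
    have "eventually (\<lambda>n. norm (1::real) \<le> 1 / (\<bar>B\<bar> + 1) * norm (f n)) sequentially"
      by (rule landau_o.smallD[OF that(1)]) simp
    then show ?thesis
      by eventually_elim (use that(2) in \<open>auto simp: field_simps\<close>)
  qed
  have lnp: "ln 2 \<le> ln (real (p n))" for n using assms(2)[of n] by simp
  have ln2: "0 < ln (2::real)" by simp
  have kd: "1 \<le> real (k n) - real (d n)" for n using assms(3)[of n] by linarith
  have k0: "0 < real (k n)" for n using assms(3)[of n] by simp
  have \<zeta>_pos: "0 < \<zeta> n" for n
  proof -
    have "0 < real (k n) - real (d n)" "0 < ln (real (p n))"
      using kd[of n] lnp[of n] ln2 by linarith+
    then show ?thesis unfolding \<zeta>_def zeta_def using k0[of n] by (intro divide_pos_pos mult_pos_pos)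
  qed
  define m where "m n = real (k n) * min (\<zeta> n) 1" for n
  define L where "L n = ln (max (1 / \<zeta> n) (exp 1))" for n
  have m_pos: "0 < m n" for n using k0 \<zeta>_pos by (simp add: m_def)
  have L: "1 \<le> L n" for n unfolding L_def by (rule one_le_ln_max_exp)

  have m_large: "eventually (\<lambda>n. B \<le> m n) sequentially" for B
  proof -
    define A where "A = \<bar>B\<bar> + 1"
    have "eventually (\<lambda>n. A * exp A / ln 2 \<le> (real (k n) - real (d n)) * real (p n)) sequentially"
      using kd by (intro unbounded assms(6)) (meson mult_nonneg_nonneg of_nat_0_le_iff order_trans zero_le_one)
    moreover have "eventually (\<lambda>n. A \<le> real (k n)) sequentially"
      by (intro unbounded assms(4)) simp
    ultimately show ?thesis
    proof eventually_elim
      case (elim n)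
      let ?x = "real (k n) - real (d n)"
      \<comment> \<open>As \<open>k - d \<ge> 1\<close> and \<open>ln p \<ge> ln 2\<close>, a bound on \<open>(k - d) ln p\<close> bounds both factors and thus \<open>(k - d) p\<close>.\<close>
      have "A \<le> ?x * ln (p n)"
      proof (rule ccontr)
        assume neg: "\<not> A \<le> ?x * ln (p n)"
        have "1 * ln (p n) \<le> ?x * ln (p n)" using kd order_trans[OF less_imp_le[OF ln2] lnp[of n]] by (intro mult_right_mono)
        then have "ln (p n) < A" using neg by simp
        then have "exp (ln (p n)) < exp A" by (simp only: exp_less_cancel_iff)
        then have pA: "real (p n) < exp A" using assms(2)[of n] by simp
        have "?x * ln 2 \<le> ?x * ln (p n)" using kd[of n] lnp by (intro mult_left_mono) auto
        then have "?x < A / ln 2" using neg ln2 by (simp add: field_simps)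
        then have "?x * real (p n) < A / ln 2 * exp A"
          using pA kd[of n] assms(2)[of n] by (intro mult_strict_mono) auto
        then show False using elim(1) by simp
      qed
      then have "A \<le> real (k n) * \<zeta> n" using k0[of n] by (simp add: \<zeta>_def zeta_def)
      then have "A \<le> m n" using elim(2) k0[of n] by (simp add: m_def min_def)
      then show ?case by (simp add: A_def)
    qed
  qed

  obtain K where K: "K > 0" and k_le: "eventually (\<lambda>n. norm (real (k n)) \<le> K * norm (real (d n) * ln (real (p n)))) sequentially"
    using landau_o.bigE[OF assms(5)] by blast
  from k_le have dln: "eventually (\<lambda>n. (1 / K) * real (k n) \<le> real (d n) * ln (real (p n))) sequentially"
  proof eventually_elim
    case (elim n)
    have "0 < ln (real (p n))" using lnp[of n] ln2 by linarith
    then show ?case using elim K by (simp add: abs_mult field_simps)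
  qed
  obtain C B where CB: "C > 0"
    "\<And>w d p k. p \<ge> 2 \<Longrightarrow> d < k \<Longrightarrow> (1 / K) * k \<le> d * ln p \<Longrightarrow> B \<le> k * min (zeta d p k) 1 \<Longrightarrow>
       0 < cutoff_time w d p k 0 \<and>
       \<bar>cutoff_time w d p k \<alpha> - cutoff_time w d p k 0\<bar>
         \<le> C * cutoff_time w d p k 0 / (sqrt (k * min (zeta d p k) 1) * ln (max (1 / zeta d p k) (exp 1)))"
    using cutoff_time_difference[of "1 / K" \<alpha>] K by (metis divide_pos_pos zero_less_one)
  have main: "eventually (\<lambda>n. 0 < t w 0 n \<and> \<bar>(t w \<alpha> n - t w 0 n) / t w 0 n\<bar> \<le> C / (sqrt (m n) * L n)) sequentially" for w
    using dln m_large[of B]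
  proof eventually_elim
    case (elim n)
    then have "0 < t w 0 n" "\<bar>t w \<alpha> n - t w 0 n\<bar> \<le> C * t w 0 n / (sqrt (m n) * L n)"
      using CB(2)[OF assms(2,3), of n n w] by (auto simp: m_def \<zeta>_def t_def L_def)
    then show ?case by (simp add: field_simps)
  qed

  have "t w \<alpha> \<sim>[sequentially] t w 0" for w
  proof (rule asymp_equivI')
    have "filterlim m at_top sequentially"
      using m_large by (simp add: filterlim_at_top)
    then have "filterlim (\<lambda>n. sqrt (m n)) at_top sequentially"
      by (rule filterlim_compose[OF sqrt_at_top])
    then have "(\<lambda>n. C / sqrt (m n)) \<longlonglongrightarrow> 0"
      by (intro tendsto_divide_0[OF tendsto_const] filterlim_at_top_imp_at_infinity)
    then have "(\<lambda>n. (t w \<alpha> n - t w 0 n) / t w 0 n) \<longlonglongrightarrow> 0"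
    proof (rule Lim_null_comparison[rotated])
      show "eventually (\<lambda>n. norm ((t w \<alpha> n - t w 0 n) / t w 0 n) \<le> C / sqrt (m n)) sequentially"
        using main[of w]
      proof eventually_elim
        case (elim n)
        then have "norm ((t w \<alpha> n - t w 0 n) / t w 0 n) \<le> C / (sqrt (m n) * L n)"
          by (simp only: real_norm_def)
        also have "\<dots> \<le> C / (sqrt (m n) * 1)"
          using CB(1) m_pos[of n] L[of n] by (intro divide_left_mono mult_left_mono) auto
        finally show ?case by (simp only: mult_1_right)
      qed
    qed
    then have "(\<lambda>n. 1 + (t w \<alpha> n - t w 0 n) / t w 0 n) \<longlonglongrightarrow> 1 + 0"
      by (intro tendsto_add tendsto_const)
    then have lim: "(\<lambda>n. 1 + (t w \<alpha> n - t w 0 n) / t w 0 n) \<longlonglongrightarrow> 1" by simp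
    show "(\<lambda>n. t w \<alpha> n / t w 0 n) \<longlonglongrightarrow> 1"
    proof (rule Lim_transform_eventually[OF lim])
      show "eventually (\<lambda>n. 1 + (t w \<alpha> n - t w 0 n) / t w 0 n = t w \<alpha> n / t w 0 n) sequentially"
        using main[of w] by eventually_elim (simp add: field_simps)
    qed
  qed
  moreover have "(\<lambda>n. (t w \<alpha> n - t w 0 n) / t w 0 n) \<in> O(\<lambda>n. 1 / (sqrt (\<zeta> n * real (k n)) * ln (max (1 / \<zeta> n) (exp 1))))"
    if bounded: "\<zeta> \<in> O(\<lambda>_. 1)" for w
  proof -
    obtain R where "eventually (\<lambda>n. norm (\<zeta> n) \<le> R * norm (1::real)) sequentially"
      using landau_o.bigE[OF bounded] by blast
    then have R: "eventually (\<lambda>n. \<zeta> n \<le> max R 1) sequentially"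
      by (elim eventually_mono) auto
    show ?thesis
    proof (rule landau_o.bigI[of "C * sqrt (max R 1)"])
      show "eventually (\<lambda>n. norm ((t w \<alpha> n - t w 0 n) / t w 0 n)
        \<le> C * sqrt (max R 1) * norm (1 / (sqrt (\<zeta> n * real (k n)) * ln (max (1 / \<zeta> n) (exp 1))))) sequentially"
        using main[of w] R
      proof eventually_elim
        case (elim n)
        have "\<zeta> n \<le> max R 1 * min (\<zeta> n) 1"
        proof (cases "\<zeta> n \<le> 1")
          case True
          have "1 * \<zeta> n \<le> max R 1 * \<zeta> n" using \<zeta>_pos[of n] by (intro mult_right_mono) auto
          then show ?thesis using True by (simp add: min_absorb1)
        qed (use elim in simp)
        then have "\<zeta> n * real (k n) \<le> max R 1 * min (\<zeta> n) 1 * real (k n)"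
          by (intro mult_right_mono) auto
        then have "sqrt (\<zeta> n * real (k n)) \<le> sqrt (max R 1 * m n)"
          by (simp add: m_def mult_ac)
        then have "sqrt (\<zeta> n * real (k n)) \<le> sqrt (max R 1) * sqrt (m n)"
          by (simp add: real_sqrt_mult)
        then have "C * sqrt (\<zeta> n * real (k n)) \<le> C * (sqrt (max R 1) * sqrt (m n))"
          using CB(1) by (intro mult_left_mono) auto
        then have "C / (sqrt (m n) * L n) \<le> C * sqrt (max R 1) / (sqrt (\<zeta> n * real (k n)) * L n)"
          using m_pos[of n] L[of n] \<zeta>_pos[of n] k0[of n] by (simp add: field_simps)
        also have "\<dots> = C * sqrt (max R 1) * norm (1 / (sqrt (\<zeta> n * real (k n)) * L n))"
          using L[of n] \<zeta>_pos[of n] k0[of n] by (simp add: abs_mult)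
        finally show ?case using elim unfolding L_def real_norm_def by linarith
      qed
    qed (use CB in simp)
  qed
  moreover have "(\<lambda>n. (t Simple \<alpha> n - t Simple 0 n) / t Simple 0 n) \<in> O(\<lambda>n. 1 / sqrt (real (k n)))"
    if "(\<lambda>_. 1) \<in> o(\<zeta>)"
  proof (rule landau_o.bigI[of C])
    have "eventually (\<lambda>n. 1 \<le> \<zeta> n) sequentially"
      using that \<zeta>_pos by (intro unbounded) (auto intro: less_imp_le)
    with main[of Simple] show "eventually (\<lambda>n. norm ((t Simple \<alpha> n - t Simple 0 n) / t Simple 0 n)
        \<le> C * norm (1 / sqrt (real (k n)))) sequentially"
    proof eventually_elim
      case (elim n)
      then have "norm ((t Simple \<alpha> n - t Simple 0 n) / t Simple 0 n) \<le> C / (sqrt (m n) * L n)"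
        by (simp only: real_norm_def)
      also have "\<dots> \<le> C / (sqrt (m n) * 1)"
        using CB(1) m_pos[of n] L[of n] by (intro divide_left_mono mult_left_mono) auto
      also have "m n = real (k n)" using elim by (simp add: m_def)
      finally show ?case by simp
    qed
  qed (use CB in simp)
  ultimately show "(\<forall>w. t w \<alpha> \<sim>[sequentially] t w 0) \<and>
      (\<zeta> \<in> O(\<lambda>_. 1) \<longrightarrow>
        (\<forall>w. (\<lambda>n. (t w \<alpha> n - t w 0 n) / t w 0 n) \<in>
              O(\<lambda>n. 1 / (sqrt (\<zeta> n * real (k n)) * ln (max (1 / \<zeta> n) (exp 1)))))) \<and>
      ((\<lambda>_. 1) \<in> o(\<zeta>) \<longrightarrow>
        (\<lambda>n. (t Simple \<alpha> n - t Simple 0 n) / t Simple 0 n) \<in> O(\<lambda>n. 1 / sqrt (real (k n))))"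
    by blast
qed

end
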